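(* Let $f\in\mathcal S_1$ with Stieltjes representation $f=a+S_1[\mu]$ ($a\ge0$, $\mu\in\mathcal M^+_1(\mathbb R_+)$), let $\beta\in(0,1)$, and let $f_{(\beta)}(s)=f(s^\beta)$, $s>0$. Then $f_{(\beta)}\in\mathcal S_\beta$ and $$f_{(\beta)}(s)=a+\mu(\{0\})s^{-\beta}+\int_0^\infty\frac{\psi_\beta(r)\,dr}{(s+r)^\beta},\qquad s>0,$$ where $\psi_\beta\in L^1_\beta(\mathbb R_+)$ is given by $$\psi_\beta(r)=\int_{(0,\infty)}\varphi_\beta\Big(\frac{r}{\tau^{1/\beta}}\Big)\frac{\mu(d\tau)}{\tau^{1/\beta}},\qquad r>0,$$ and, for $t>0$, $$\varphi_\beta(t)=\frac{2\beta\sin(\pi\beta)}{\pi}\int_0^1\frac{t^{2\beta-1}\big(1+\cos(\pi\beta)t^\beta r^\beta\big)r^\beta\,dr}{\big(t^{2\beta}r^{2\beta}+2\cos(\pi\beta)t^\beta r^\beta+1\big)^2(1-r)^{1-\beta}}.$$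
   Context: $\mathbb R_+=[0,\infty)$. For $\alpha\ge0$, $\mathcal M^+_\alpha(\mathbb R_+)$ is the set of positive Borel measures $\mu$ on $\mathbb R_+$ with $\int_{\mathbb R_+}(1+t)^{-\alpha}\mu(dt)<\infty$, and for $\alpha>0$, $S_\alpha[\mu](z)=\int_{\mathbb R_+}\frac{\mu(dt)}{(z+t)^\alpha}$. For $\alpha>0$, $\mathcal S_\alpha$ is the class of functions $f:(0,\infty)\to[0,\infty)$ of the form $f=a+S_\alpha[\mu]$ with $a\ge0$ and $\mu\in\mathcal M^+_\alpha(\mathbb R_+)$; $(a,\mu)$ is uniquely determined by $f$ (Stieltjes representation). $L^1_\beta(\mathbb R_+)=L^1(\mathbb R_+;(1+t)^{-\beta}dt)$. *)

theory Defs
  imports "HOL-Analysis.Analysis"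
begin

definition stieltjes_measure :: "real \<Rightarrow> real measure \<Rightarrow> bool" where
  "stieltjes_measure \<alpha> \<mu> \<longleftrightarrow>
     sets \<mu> = sets (restrict_space borel {0..}) \<and>
     (\<integral>\<^sup>+ t. ennreal ((1 + t) powr (-\<alpha>)) \<partial>\<mu>) < \<infinity>"

definition stieltjes_transform :: "real \<Rightarrow> real measure \<Rightarrow> real \<Rightarrow> real" where
  "stieltjes_transform \<alpha> \<mu> z = (\<integral> t. (z + t) powr (-\<alpha>) \<partial>\<mu>)"

definition stieltjes_class :: "real \<Rightarrow> (real \<Rightarrow> real) \<Rightarrow> bool" where
  "stieltjes_class \<alpha> f \<longleftrightarrow>
     (\<exists>a \<ge> 0. \<exists>\<mu>. stieltjes_measure \<alpha> \<mu> \<and>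
        (\<forall>z > 0. f z = a + stieltjes_transform \<alpha> \<mu> z))"

definition L1_weighted :: "real \<Rightarrow> (real \<Rightarrow> real) \<Rightarrow> bool" where
  "L1_weighted \<beta> g \<longleftrightarrow> set_integrable lborel {0..} (\<lambda>t. (1 + t) powr (-\<beta>) * g t)"

definition phi_beta :: "real \<Rightarrow> real \<Rightarrow> real" where
  "phi_beta \<beta> t = 2 * \<beta> * sin (pi * \<beta>) / pi *
     (LINT r:{0<..<1}|lborel.
        t powr (2*\<beta> - 1) * (1 + cos (pi * \<beta>) * t powr \<beta> * r powr \<beta>) * r powr \<beta> /
        ((t powr (2*\<beta>) * r powr (2*\<beta>) + 2 * cos (pi * \<beta>) * t powr \<beta> * r powr \<beta> + 1)\<^sup>2
         * (1 - r) powr (1 - \<beta>)))"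

definition psi_beta :: "real \<Rightarrow> real measure \<Rightarrow> real \<Rightarrow> real" where
  "psi_beta \<beta> \<mu> r =
     (LINT \<tau>:{0<..}|\<mu>. phi_beta \<beta> (r / \<tau> powr (1/\<beta>)) / \<tau> powr (1/\<beta>))"

end

(* The function 1/(1+s^beta) has an order-one Stieltjes representation with density
   g(u) = (sin(pi beta)/pi) u^beta / (u^(2 beta) + 2 cos(pi beta) u^beta + 1), read off from its jump
   across the negative half-axis (residue theorem on the rectangle |Re w| <= R, |Im w| <= pi after
   z = e^w).  Solving the Abel equation that links Stieltjes kernels of orders 1 and beta turns g
   into phi_beta, so that 1/(1+s^beta) is the order-beta transform of phi_beta; here this is checked
   directly by Fubini and one integration by parts.  Scaling and Tonelli over mu then give the formula.

   The point that is not visible from the definition is phi_beta >= 0, because 1 + cos(pi beta) y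
   changes sign when beta > 1/2.  For t <= 1 the integrand is nonnegative.  For t >= 1 note that
   phi_beta(t) is a negative multiple of the imaginary part of the integral over (-t,0), upper side,
   of (z+t)^(beta-1) / (1+z^beta)^2.  The integral of this function over the whole upper side of the
   real line vanishes, it is real on the positive half-axis, and on z < -t its imaginary part is a
   nonnegative multiple of |z|^(2 beta) - 1. *)

theory Submission
  imports Defs "HOL-Complex_Analysis.Complex_Analysis"
begin

section \<open>Integrability and bounds\<close>

text \<open>Positivity of \<open>phi_beta\<close> is used twice: the class asks for a positive
  measure, and the integrals over r and \<open>\<mu>\<close> are exchanged as nonnegative integrals.
  Absolute values with \<open>phi_beta_bound\<close> would give only O(log \<tau> / \<tau>) after
  scaling, which integrability of 1/(1+\<tau>) does not control. Abel step: 1/(x+s) is \<beta>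
  x^\<beta> times the integral over 0<r<1 of (1-r)^(\<beta>-1) (s r + x)^(-\<beta>-1). This passes
  from order 1 to order \<beta>+1; integration by parts in x lowers it to \<beta>. Differentiating
  y^2/(y^2 + 2 cos(pi \<beta>) y + 1) at y = x^\<beta> creates the factor 1 + cos(pi \<beta>) y and
  the squared denominator, and t = x/r gives the integral over r. Rotation: at z^\<beta> = y e^(i pi
  \<beta>) the imaginary part of 1/(1+z^\<beta>)^2 is -2 sin(pi \<beta>)
  \<open>kfun \<beta> y\<close>; hence the square there. The branch point z = -t lies on the
  contour. With z = t e^w the half-plane becomes the strip 0 < Im w < pi; its upper edge is reached
  from lower horizontal lines by dominated convergence, with one dominating function for all
  heights.\<close>

lemma exp_substitution:
  fixes f :: "real \<Rightarrow> real"
  assumes [measurable]: "f \<in> borel_measurable borel"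
  shows "integrable lborel (\<lambda>v. exp v * f (exp v)) \<longleftrightarrow> set_integrable lborel {0<..} f" (is ?A)
    and "(LINT v|lborel. exp v * f (exp v)) = (LINT x:{0<..}|lborel. f x)" (is ?B)
proof -
  \<comment> \<open>The change of variables theorem speaks of absolute integrability on the
    completed Lebesgue measure; \<open>l\<close> and \<open>r\<close> transfer it to
    \<open>lborel\<close>. The substitution connects the half-axis with the horizontal lines of the
    contour integrals.\<close>
  have cov: "(\<lambda>x. \<bar>exp x\<bar> * f (exp x)) absolutely_integrable_on UNIV \<and>
      integral UNIV (\<lambda>x. \<bar>exp x\<bar> * f (exp x)) = b
     \<longleftrightarrow> f absolutely_integrable_on (range exp) \<and> integral (range exp) f = b" for b
    by (rule has_absolute_integral_change_of_variables_1')
       (auto intro!: derivative_eq_intros simp: inj_on_def)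
  have range: "range exp = {0::real<..}"
    by (auto simp: image_iff) (metis exp_ln)
  have l: "(\<lambda>x. \<bar>exp x\<bar> * f (exp x)) absolutely_integrable_on UNIV
      \<longleftrightarrow> integrable lborel (\<lambda>v. exp v * f (exp v))"
    unfolding set_integrable_def by (simp add: integrable_completion)
  have r: "f absolutely_integrable_on {0<..} \<longleftrightarrow> set_integrable lborel {0<..} f"
    unfolding set_integrable_def by (intro integrable_completion) measurable
  show A: ?A using cov l r range by metis
  show ?B
  proof (cases "set_integrable lborel {0<..} f")
    case True
    have "(LINT v|lborel. exp v * f (exp v)) = integral UNIV (\<lambda>x. \<bar>exp x\<bar> * f (exp x))"
      using True A by (simp add: integral_lborel)
    also have "\<dots> = integral {0<..} f"
      using cov r True range by metis
    also have "\<dots> = (LINT x:{0<..}|lborel. f x)"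
      using True by (rule set_borel_integral_eq_integral(2)[symmetric])
    finally show ?thesis .
  next
    \<comment> \<open>Without integrability both Bochner integrals have the default value 0.\<close>
    case False
    with A show ?thesis
      by (simp add: not_integrable_integral_eq set_lebesgue_integral_def set_integrable_def)
  qed
qed

text \<open>The integrand is the derivative of -1/(\<beta> (1 + x^\<beta>)), which has finite limits
  at 0 and at infinity. It serves as comparison function for many later estimates; with 1 +
  x^\<beta> unsquared it would decay only like 1/x.\<close>

lemma powr_kernel_integrable:
  fixes \<beta> :: real
  assumes "0 < \<beta>"
  shows "set_integrable lborel {0<..} (\<lambda>x. x powr (\<beta> - 1) / (1 + x powr \<beta>)\<^sup>2)"
proof -
  let ?F = "\<lambda>x::real. - (1 / (\<beta> * (1 + x powr \<beta>)))"
  have pos: "1 + x powr \<beta> > 0" for x :: real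
    using powr_ge_zero[of x \<beta>] by linarith
  have "set_integrable lborel (einterval 0 \<infinity>) (\<lambda>x. x powr (\<beta> - 1) / (1 + x powr \<beta>)\<^sup>2)"
  proof (rule interval_integral_FTC_nonneg[where F = ?F and A = "- (1 / \<beta>)" and B = 0])
    fix x :: real assume "0 < ereal x"
    then have x: "x > 0" by simp
    show "DERIV ?F x :> x powr (\<beta> - 1) / (1 + x powr \<beta>)\<^sup>2"
      using x pos[of x] assms
      by (auto intro!: derivative_eq_intros simp: divide_simps power2_eq_square)
    show "isCont (\<lambda>x. x powr (\<beta> - 1) / (1 + x powr \<beta>)\<^sup>2) x"
      using x pos[of x] by (auto intro!: continuous_intros)
  next
    have "(?F \<longlongrightarrow> - (1 / (\<beta> * (1 + 0)))) (at_right 0)"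
      using assms
      by (intro tendsto_intros) (auto intro!: tendsto_eq_intros simp: eventually_at_right_less
          eventually_at_filter)
    then show "((?F \<circ> real_of_ereal) \<longlongrightarrow> - (1 / \<beta>)) (at_right 0)"
      by (simp add: ereal_tendsto_simps zero_ereal_def)
  next
    have "filterlim (\<lambda>x. \<beta> * (1 + x powr \<beta>)) at_top at_top"
      using assms by real_asymp
    then have "(?F \<longlongrightarrow> 0) at_top"
      using tendsto_minus[OF tendsto_divide_0[OF tendsto_const filterlim_at_top_imp_at_infinity], of _ _ 1]
      by simp
    then show "((?F \<circ> real_of_ereal) \<longlongrightarrow> 0) (at_left \<infinity>)"
      by (simp add: ereal_tendsto_simps)
  qed (auto)
  moreover have "einterval 0 \<infinity> = {0<..}"
    by (auto simp: einterval_def)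
  ultimately show ?thesis by simp
qed

lemma beta_kernel_integrable:
  fixes \<beta> :: real
  assumes "0 < \<beta>" "\<beta> < 1"
  shows "set_integrable lborel {0<..<1} (\<lambda>r. r powr (-\<beta>) * (1 - r) powr (\<beta> - 1))"
    and "set_integrable lborel {0<..<1} (\<lambda>r. (1 - r) powr (\<beta> - 1))"
proof -
  have "set_integrable lborel {0..1} (\<lambda>r. r powr ((1-\<beta>) - 1) * (1 - r) powr (\<beta> - 1))"
    using assms by (intro integrable_Beta) auto
  then have *: "set_integrable lborel {0..1} (\<lambda>r. r powr (-\<beta>) * (1 - r) powr (\<beta> - 1))" by simp
  show 1: "set_integrable lborel {0<..<1} (\<lambda>r. r powr (-\<beta>) * (1 - r) powr (\<beta> - 1))"
    by (rule set_integrable_subset[OF *]) auto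
  show "set_integrable lborel {0<..<1} (\<lambda>r. (1 - r) powr (\<beta> - 1))"
  proof (rule set_integrable_bound[OF 1])
    \<comment> \<open>On (0,1) the factor \<open>r powr (-\<beta>)\<close> only enlarges the
      integrand, so the second claim follows from the first.\<close>
    have "1 \<le> r powr (-\<beta>)" if "0 < r" "r < 1" for r :: real
      using powr_mono'[of "-\<beta>" 0 r] that assms by simp
    then show "AE r in lborel. r \<in> {0<..<1} \<longrightarrow>
        norm ((1 - r) powr (\<beta> - 1)) \<le> norm (r powr (-\<beta>) * (1 - r) powr (\<beta> - 1))"
      by (auto simp: abs_mult intro!: AE_I2 mult_right_mono[of 1, simplified])
  qed (auto simp: set_borel_measurable_def)
qed

text \<open>The singularity at x = 1 is the image of the branch point z = -t on the negative axis.
  It is integrable because \<beta> - 1 > -1, and the tail behaves like x^(-\<beta>-1).\<close>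

lemma abs_powr_kernel_integrable:
  fixes \<beta> :: real
  assumes "0 < \<beta>" "\<beta> < 1"
  shows "set_integrable lborel {0<..} (\<lambda>x. \<bar>x - 1\<bar> powr (\<beta> - 1) / (1 + x powr \<beta>)\<^sup>2)"
proof -
  let ?f = "\<lambda>x::real. \<bar>x - 1\<bar> powr (\<beta> - 1) / (1 + x powr \<beta>)\<^sup>2"
  have pos: "1 \<le> (1 + x powr \<beta>)\<^sup>2" for x :: real
    using powr_ge_zero[of x \<beta>] by (simp add: power2_eq_square algebra_simps)
  have 1: "set_integrable lborel {0<..<1} ?f"
  proof (rule set_integrable_bound[OF beta_kernel_integrable(2)[OF assms]])
    show "AE x in lborel. x \<in> {0<..<1} \<longrightarrow> norm (?f x) \<le> norm ((1 - x) powr (\<beta> - 1))"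
    proof (intro AE_I2 impI)
      fix x :: real assume "x \<in> {0<..<1}"
      then have "norm (?f x) = (1 - x) powr (\<beta> - 1) / (1 + x powr \<beta>)\<^sup>2"
        by simp
      also have "\<dots> \<le> (1 - x) powr (\<beta> - 1) / 1"
        using pos[of x] by (intro divide_left_mono) (auto simp: zero_less_mult_iff simp del: one_le_power)
      finally show "norm (?f x) \<le> norm ((1 - x) powr (\<beta> - 1))" by simp
    qed
  qed (auto simp: set_borel_measurable_def)
  \<comment> \<open>After the shift x = 1 + u the numerator is u^(\<beta>-1), and (1+u)^\<beta>
    \<ge> u^\<beta> allows comparison with the kernel on the half-axis.\<close>
  have "set_integrable lborel {0<..} (\<lambda>u. ?f (1 + 1 * u))"
  proof (rule set_integrable_bound[OF powr_kernel_integrable[OF assms(1)]])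
    show "AE x in lborel. x \<in> {0<..} \<longrightarrow>
      norm (?f (1 + 1 * x)) \<le> norm (x powr (\<beta> - 1) / (1 + x powr \<beta>)\<^sup>2)"
      using assms by (auto intro!: AE_I2 divide_left_mono power_mono powr_mono2 mult_pos_pos
         zero_less_power add_pos_nonneg)
  qed (auto simp: set_borel_measurable_def)
  moreover have "(\<lambda>u. indicator {0<..} u *\<^sub>R ?f (1 + 1 * u)) =
     (\<lambda>u. (\<lambda>x. indicator {1<..} x *\<^sub>R ?f x) (1 + 1 * u))"
    by (auto simp: indicator_def)
  ultimately have 2: "set_integrable lborel {1<..} ?f"
    unfolding set_integrable_def using lborel_integrable_real_affine_iff[of 1
        "\<lambda>x. indicator {1<..} x *\<^sub>R ?f x" 1]
    by (simp only: simp_thms one_neq_zero)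
  have "set_integrable lborel ({0<..<1} \<union> {1<..}) ?f"
    by (intro set_integrable_Un 1 2) auto
  moreover have "AE x in lborel. indicator ({0<..<1} \<union> {1<..}) x *\<^sub>R ?f x = indicator {0<..} x *\<^sub>R ?f x"
    using AE_lborel_singleton[of "1::real"] by eventually_elim (auto simp: indicator_def)
  ultimately show ?thesis
    unfolding set_integrable_def by (subst integrable_cong_AE[symmetric]) auto
qed

text \<open>For real y this is |1 + y e^(i pi \<beta>)|^2, the squared modulus of 1 + z^\<beta> on
  either side of the negative axis.\<close>

definition kden :: "real \<Rightarrow> real \<Rightarrow> real" where
  "kden \<beta> y = y\<^sup>2 + 2 * cos (pi * \<beta>) * y + 1"

text \<open>Twice this function is the derivative of \<open>y\<^sup>2 / kden \<beta> y\<close>; this is what makes the integration by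
  parts work.\<close>

definition kfun :: "real \<Rightarrow> real \<Rightarrow> real" where
  "kfun \<beta> y = y * (1 + cos (pi * \<beta>) * y) / (kden \<beta> y)\<^sup>2"

text \<open>This is cos(pi \<beta> / 2)^2, the minimum of \<open>kden \<beta> y\<close> / (1+y)^2
  over y \<ge> 0, attained at y = 1.\<close>

definition kconst :: "real \<Rightarrow> real" where
  "kconst \<beta> = (1 + cos (pi * \<beta>)) / 2"

lemma kconst_pos: assumes "0 < \<beta>" "\<beta> < 1" shows "kconst \<beta> > 0"
proof -
  have "cos (pi * \<beta>) > cos pi"
    using assms by (intro cos_monotone_0_pi) auto
  then show ?thesis by (simp add: kconst_def)
qed

text \<open>With c = cos(pi \<beta>), the quadratic splits as (1+c)/2 (1+y)^2 + (1-c)/2 (1-y)^2, and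
  the second term is nonnegative.\<close>

lemma kden_ge: "kden \<beta> y \<ge> kconst \<beta> * (1 + y)\<^sup>2"
proof -
  have "kden \<beta> y - kconst \<beta> * (1 + y)\<^sup>2 = (1 - cos (pi * \<beta>)) / 2 * (y - 1)\<^sup>2"
    by (simp add: kden_def kconst_def power2_eq_square field_simps)
  moreover have "\<dots> \<ge> 0" by simp
  ultimately show ?thesis by linarith
qed

lemma kden_pos:
  assumes "0 < \<beta>" "\<beta> < 1" "y \<ge> 0"
  shows "kden \<beta> y > 0"
proof -
  have "kconst \<beta> * (1 + y)\<^sup>2 > 0" using kconst_pos[of \<beta>] assms by auto
  then show ?thesis using kden_ge[of \<beta> y] by linarith
qed

text \<open>The numerator is at most (1+y)^2 in absolute value, and the squared denominator is at
  least a constant times (1+y)^4.\<close>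

lemma kfun_bound:
  assumes "0 < \<beta>" "\<beta> < 1" "y \<ge> 0"
  shows "\<bar>kfun \<beta> y\<bar> \<le> 1 / (kconst \<beta>)\<^sup>2 / (1 + y)\<^sup>2"
proof -
  have "\<bar>1 + cos (pi * \<beta>) * y\<bar> \<le> 1 + \<bar>cos (pi * \<beta>)\<bar> * y"
    using assms abs_triangle_ineq[of 1 "cos (pi * \<beta>) * y"] by (simp add: abs_mult)
  also have "\<dots> \<le> 1 + 1 * y" using assms by (intro add_left_mono mult_right_mono) auto
  finally have 1: "\<bar>y * (1 + cos (pi * \<beta>) * y)\<bar> \<le> (1 + y) * (1 + y)"
    unfolding abs_mult using assms by (intro mult_mono) auto
  have 2: "(kconst \<beta> * (1 + y)\<^sup>2)\<^sup>2 \<le> (kden \<beta> y)\<^sup>2"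
    using kden_ge kconst_pos[of \<beta>] assms by (intro power_mono) auto
  have "\<bar>kfun \<beta> y\<bar> \<le> (1 + y) * (1 + y) / (kconst \<beta> * (1 + y)\<^sup>2)\<^sup>2"
    unfolding kfun_def abs_divide
    using 1 2 assms kconst_pos[of \<beta>] by (intro frac_le) auto
  also have "\<dots> = 1 / (kconst \<beta>)\<^sup>2 / (1 + y)\<^sup>2"
    using assms kconst_pos[of \<beta>] by (simp add: power2_eq_square divide_simps)
  finally show ?thesis .
qed

lemma kfun_measurable [measurable]: "kfun \<beta> \<in> borel_measurable borel"
  unfolding kfun_def kden_def by measurable

lemma kden_measurable [measurable]: "kden \<beta> \<in> borel_measurable borel"
  unfolding kden_def by measurable

text \<open>Collecting all occurrences of t r into (t r)^\<beta> exposes the Abel structure: apart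
  from a power of t, the variables interact only through this product.\<close>

lemma phi_beta_alt:
  assumes "t > 0"
  shows "phi_beta \<beta> t = 2 * \<beta> * sin (pi * \<beta>) / pi * (t powr (\<beta> - 1) *
     (LINT r:{0<..<1}|lborel. kfun \<beta> ((t * r) powr \<beta>) * (1 - r) powr (\<beta> - 1)))"
proof -
  have e: "t powr (2*\<beta> - 1) * (1 + cos (pi * \<beta>) * t powr \<beta> * r powr \<beta>) * r powr \<beta> /
        ((t powr (2*\<beta>) * r powr (2*\<beta>) + 2 * cos (pi * \<beta>) * t powr \<beta> * r powr \<beta> + 1)\<^sup>2
         * (1 - r) powr (1 - \<beta>)) = t powr (\<beta> - 1) * (kfun \<beta> ((t * r) powr \<beta>) * (1 - r) powr (\<beta> - 1))"
    if "0 < r" "r < 1" for r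
  proof -
    have a: "(t * r) powr \<beta> = t powr \<beta> * r powr \<beta>" using that assms by (simp add: powr_mult)
    have b: "t powr (2*\<beta>) = t powr \<beta> * t powr \<beta>" "r powr (2*\<beta>) = r powr \<beta> * r powr \<beta>"
      by (simp_all flip: powr_add)
    \<comment> \<open>One factor \<open>t powr \<beta>\<close> is absorbed into the numerator of
      \<open>kfun\<close>, so only \<open>t powr (\<beta> - 1)\<close> stays outside.\<close>
    have c: "t powr (2*\<beta> - 1) = t powr (\<beta> - 1) * t powr \<beta>"
      by (simp flip: powr_add)
    have d: "(1 - r) powr (\<beta> - 1) = 1 / (1 - r) powr (1 - \<beta>)"
      using powr_minus_divide[of "1-r" "1-\<beta>"] by simp
    have "t powr \<beta> * t powr \<beta> * (r powr \<beta> * r powr \<beta>) + 2 * cos (pi * \<beta>) * t powr \<beta> * r powr \<beta> + 1 =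
        (t powr \<beta> * r powr \<beta>)\<^sup>2 + 2 * cos (pi * \<beta>) * (t powr \<beta> * r powr \<beta>) + 1"
      by (simp add: power2_eq_square mult_ac)
    then show ?thesis unfolding kfun_def kden_def a b c d
      by (simp add: mult_ac)
  qed
  show ?thesis unfolding phi_beta_def
    by (subst set_integral_mult_right[symmetric],
      intro arg_cong2[where f = "(*)"] refl set_lebesgue_integral_cong) (auto simp: e)
qed

text \<open>One of the two factors 1/(1 + (t r)^\<beta>) is discarded; the other is separated by
  r^\<beta> (1 + t^\<beta>) \<le> 1 + (t r)^\<beta>. The result is a product of a function of t and
  an integrable function of r, as needed for Fubini.\<close>

lemma phi_integrand_bound:
  assumes "0 < \<beta>" "\<beta> < 1" "t > 0" "0 < r" "r < 1"
  shows "\<bar>kfun \<beta> ((t * r) powr \<beta>) * (1 - r) powr (\<beta> - 1)\<bar>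
     \<le> 1 / (kconst \<beta>)\<^sup>2 / (1 + t powr \<beta>) * (r powr (-\<beta>) * (1 - r) powr (\<beta> - 1))"
proof -
  have y: "(t * r) powr \<beta> = t powr \<beta> * r powr \<beta>" using assms by (simp add: powr_mult)
  have r1: "r powr \<beta> \<le> 1" using assms by (simp add: powr_le1)
  have p: "1 + (t * r) powr \<beta> \<ge> 1" "1 + t powr \<beta> > 0" "r powr \<beta> > 0"
    using assms by (auto simp: add_pos_nonneg)
  have "\<bar>kfun \<beta> ((t * r) powr \<beta>)\<bar> \<le> 1 / (kconst \<beta>)\<^sup>2 / (1 + (t * r) powr \<beta>)\<^sup>2"
    using assms by (intro kfun_bound) auto
  then have 1: "\<bar>kfun \<beta> ((t * r) powr \<beta>)\<bar> \<le> 1 / (kconst \<beta>)\<^sup>2 * (1 / (1 + (t * r) powr \<beta>)\<^sup>2)" by simp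
  have "1 / (1 + (t * r) powr \<beta>)\<^sup>2 \<le> 1 / (1 + (t * r) powr \<beta>)"
  proof (rule divide_left_mono)
    show "1 + (t * r) powr \<beta> \<le> (1 + (t * r) powr \<beta>)\<^sup>2"
      using p(1) power_increasing[of 1 2 "1 + (t * r) powr \<beta>"] by simp
    show "0 < (1 + (t * r) powr \<beta>)\<^sup>2 * (1 + (t * r) powr \<beta>)"
      using p(1) by (intro mult_pos_pos zero_less_power) linarith+
  qed simp
  also have "\<dots> \<le> r powr (-\<beta>) / (1 + t powr \<beta>)"
  proof -
    have "r powr \<beta> * (1 + t powr \<beta>) \<le> 1 + (t * r) powr \<beta>"
      using r1 unfolding y by (simp add: algebra_simps)
    moreover have "r powr (-\<beta>) / (1 + t powr \<beta>) = 1 / (r powr \<beta> * (1 + t powr \<beta>))"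
      by (simp add: powr_minus divide_simps)
    ultimately show ?thesis using p by (simp add: frac_le)
  qed
  finally have "1 / (1 + (t * r) powr \<beta>)\<^sup>2 \<le> r powr (-\<beta>) / (1 + t powr \<beta>)" .
  from order_trans[OF 1 mult_left_mono[OF this]]
  have "\<bar>kfun \<beta> ((t * r) powr \<beta>)\<bar> \<le> 1 / (kconst \<beta>)\<^sup>2 * (r powr (-\<beta>) / (1 + t powr \<beta>))"
    by simp
  then have "\<bar>kfun \<beta> ((t * r) powr \<beta>)\<bar> * (1 - r) powr (\<beta> - 1)
    \<le> 1 / (kconst \<beta>)\<^sup>2 * (r powr (-\<beta>) / (1 + t powr \<beta>)) * (1 - r) powr (\<beta> - 1)"
    by (intro mult_right_mono) auto
  then show ?thesis by (simp add: abs_mult mult_ac)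
qed

lemma phi_integrand_integrable:
  assumes "0 < \<beta>" "\<beta> < 1" "t > 0"
  shows "set_integrable lborel {0<..<1} (\<lambda>r. kfun \<beta> ((t * r) powr \<beta>) * (1 - r) powr (\<beta> - 1))"
proof (rule set_integrable_bound)
  show "set_integrable lborel {0<..<1} (\<lambda>r. 1 / (kconst \<beta>)\<^sup>2 / (1 + t powr \<beta>) * (r powr (-\<beta>) * (1 - r) powr (\<beta> - 1)))"
    by (intro set_integrable_mult_right beta_kernel_integrable assms)
  show "AE r in lborel. r \<in> {0<..<1} \<longrightarrow>
     norm (kfun \<beta> ((t * r) powr \<beta>) * (1 - r) powr (\<beta> - 1)) \<le>
     norm (1 / (kconst \<beta>)\<^sup>2 / (1 + t powr \<beta>) * (r powr (-\<beta>) * (1 - r) powr (\<beta> - 1)))"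
    using phi_integrand_bound[OF assms] by (intro AE_I2 impI) (auto intro: order_trans[OF _ abs_ge_self])
qed (auto simp: set_borel_measurable_def)

lemma phi_beta_bound:
  assumes "0 < \<beta>" "\<beta> < 1"
  obtains C where "C \<ge> 0" "\<And>t. t > 0 \<Longrightarrow> \<bar>phi_beta \<beta> t\<bar> \<le> C * (t powr (\<beta> - 1) / (1 + t powr \<beta>))"
proof -
  let ?B = "LINT r:{0<..<1}|lborel. r powr (-\<beta>) * (1 - r) powr (\<beta> - 1)"
  let ?c = "2 * \<beta> * sin (pi * \<beta>) / pi"
  define C where "C = \<bar>?c\<bar> * (?B / (kconst \<beta>)\<^sup>2)"
  have B0: "?B \<ge> 0" unfolding set_lebesgue_integral_def by (intro integral_nonneg_AE) auto
  have "\<bar>phi_beta \<beta> t\<bar> \<le> C * (t powr (\<beta> - 1) / (1 + t powr \<beta>))" if t: "t > 0" for t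
  proof -
    let ?I = "LINT r:{0<..<1}|lborel. kfun \<beta> ((t * r) powr \<beta>) * (1 - r) powr (\<beta> - 1)"
    have "norm ?I \<le> (LINT r:{0<..<1}|lborel. norm (kfun \<beta> ((t * r) powr \<beta>) * (1 - r) powr (\<beta> - 1)))"
      using phi_integrand_integrable[OF assms t] by (intro set_integral_norm_bound)
    also have "\<dots> \<le> (LINT r:{0<..<1}|lborel. 1 / (kconst \<beta>)\<^sup>2 / (1 + t powr \<beta>) * (r powr (-\<beta>) * (1 - r) powr (\<beta> - 1)))"
      using phi_integrand_bound[OF assms t]
      by (intro set_integral_mono set_integrable_norm set_integrable_mult_right
         phi_integrand_integrable beta_kernel_integrable assms t) auto
    also have "\<dots> = 1 / (kconst \<beta>)\<^sup>2 / (1 + t powr \<beta>) * ?B" by (rule set_integral_mult_right)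
    finally have I: "\<bar>?I\<bar> \<le> 1 / (kconst \<beta>)\<^sup>2 / (1 + t powr \<beta>) * ?B" by simp
    have "\<bar>phi_beta \<beta> t\<bar> = \<bar>?c\<bar> * (t powr (\<beta> - 1) * \<bar>?I\<bar>)"
      by (simp add: phi_beta_alt[OF t] abs_mult)
    also have "\<dots> \<le> \<bar>?c\<bar> * (t powr (\<beta> - 1) * (1 / (kconst \<beta>)\<^sup>2 / (1 + t powr \<beta>) * ?B))"
      using I by (intro mult_left_mono) auto
    also have "\<dots> = C * (t powr (\<beta> - 1) / (1 + t powr \<beta>))" by (simp add: C_def mult_ac)
    finally show ?thesis .
  qed
  moreover have "C \<ge> 0" using B0 by (simp add: C_def)
  ultimately show ?thesis using that by blast
qed

lemma phi_beta_measurable [measurable]: "phi_beta \<beta> \<in> borel_measurable borel"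
  unfolding phi_beta_def set_lebesgue_integral_def by measurable

section \<open>Contour integrals along strips\<close>

lemma has_contour_integral_linepath_horizontal:
  assumes "l < r"
  shows "(f has_contour_integral I) (linepath (Complex l a) (Complex r a)) \<longleftrightarrow>
    ((\<lambda>x. f (Complex x a)) has_integral I) {l..r}"
proof -
  have lp: "linepath (Complex l a) (Complex r a) x = linepath (of_real l) (of_real r) x + \<i> * of_real a" for x
    by (simp add: linepath_def complex_eq_iff algebra_simps)
  have d: "Complex r a - Complex l a = of_real r - of_real l"
    by (simp add: complex_eq_iff)
  have "(f has_contour_integral I) (linepath (Complex l a) (Complex r a)) \<longleftrightarrow>
     ((\<lambda>z. f (z + \<i> * of_real a)) has_contour_integral I) (linepath (of_real l) (of_real r))"
    unfolding has_contour_integral_linepath lp d by simp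
  also have "\<dots> \<longleftrightarrow> ((\<lambda>x. f (of_real x + \<i> * of_real a)) has_integral I) {l..r}"
    using assms by (subst has_contour_integral_linepath_Reals_iff) auto
  also have "(\<lambda>x. f (of_real x + \<i> * of_real a)) = (\<lambda>x. f (Complex x a))"
    by (simp add: Complex_eq)
  finally show ?thesis .
qed

text \<open>The vertical sides of the rectangle contribute at most (b - a)(B(R) + B(-R)), which
  tends to 0. Continuity is asked only on the two lines and beyond \<open>\<rho>\<close>, so that a
  pole may lie in the middle; its contribution enters through \<open>c\<close>.\<close>

lemma strip_contour:
  fixes f :: "complex \<Rightarrow> complex" and a b \<rho> :: real
  assumes ab: "a < b"
    and cont: "continuous_on {z. Im z = a \<or> Im z = b \<or> (a \<le> Im z \<and> Im z \<le> b \<and> \<rho> \<le> \<bar>Re z\<bar>)} f"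
    and ia: "integrable lborel (\<lambda>x. f (Complex x a))"
    and ib: "integrable lborel (\<lambda>x. f (Complex x b))"
    and bound: "\<And>z. a \<le> Im z \<Longrightarrow> Im z \<le> b \<Longrightarrow> \<rho> \<le> \<bar>Re z\<bar> \<Longrightarrow> norm (f z) \<le> B (Re z)"
    and B: "(B \<longlongrightarrow> 0) at_top" "(B \<longlongrightarrow> 0) at_bot"
    and c: "\<forall>\<^sub>F R in at_top. contour_integral (rectpath (Complex (-R) a) (Complex R b)) f = c"
  shows "(LINT x|lborel. f (Complex x a)) - (LINT x|lborel. f (Complex x b)) = c"
proof -
  let ?I = "\<lambda>h R. LINT x:{-R..R}|lborel. f (Complex x h)"
  have lim: "((?I h) \<longlongrightarrow> (LINT x|lborel. f (Complex x h))) at_top"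
    if "integrable lborel (\<lambda>x. f (Complex x h))" for h
    unfolding set_lebesgue_integral_def
  proof (rule integral_dominated_convergence_at_top)
    show "integrable lborel (\<lambda>x. norm (f (Complex x h)))" using that by simp
    show "AE x in lborel. ((\<lambda>R. indicat_real {- R..R} x *\<^sub>R f (Complex x h)) \<longlongrightarrow> f (Complex x h)) at_top"
    proof (rule AE_I2)
      fix x :: real
      have "\<forall>\<^sub>F R in at_top. indicat_real {- R..R} x *\<^sub>R f (Complex x h) = f (Complex x h)"
        using eventually_ge_at_top[of "\<bar>x\<bar>"] by eventually_elim (auto simp: indicator_def)
      then show "((\<lambda>R. indicat_real {- R..R} x *\<^sub>R f (Complex x h)) \<longlongrightarrow> f (Complex x h)) at_top"
        by (rule tendsto_eventually)
    qed
    show "\<forall>\<^sub>F R in at_top. AE x in lborel. norm (indicat_real {- R..R} x *\<^sub>R f (Complex x h)) \<le> norm (f (Complex x h))"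
      by (intro always_eventually allI AE_I2) (auto simp: indicator_def)
  qed (use that in auto)
  \<comment> \<open>The error is exactly the contribution of the two vertical sides.
    \<open>R \<ge> \<rho>\<close> puts them where \<open>B\<close> bounds \<open>f\<close>, and
    \<open>R \<ge> 1\<close> keeps -R < R.\<close>
  have bnd: "norm (c - (?I a R - ?I b R)) \<le> (B R + B (-R)) * (b - a)"
    if R: "R \<ge> max 1 \<rho>" and cR: "contour_integral (rectpath (Complex (-R) a) (Complex R b)) f = c" for R
  proof -
    have seg_h: "closed_segment (Complex u h) (Complex v h) \<subseteq> {z. Im z = h}" for u v h
    proof -
      have "convex ({z. h \<le> Im z} \<inter> {z. Im z \<le> h})"
        by (intro convex_Int convex_halfspace_Im_ge convex_halfspace_Im_le)
      then have "closed_segment (Complex u h) (Complex v h) \<subseteq> {z. h \<le> Im z} \<inter> {z. Im z \<le> h}"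
        by (intro closed_segment_subset) auto
      also have "{z. h \<le> Im z} \<inter> {z. Im z \<le> h} = {z. Im z = h}" by auto
      finally show ?thesis .
    qed
    have seg_v: "Re z = u \<and> a \<le> Im z \<and> Im z \<le> b"
      if "z \<in> closed_segment (Complex u p) (Complex u q)" "a \<le> p" "p \<le> b" "a \<le> q" "q \<le> b" for z u p q
    proof -
      have "convex ({z. u \<le> Re z} \<inter> {z. Re z \<le> u} \<inter> {z. a \<le> Im z} \<inter> {z. Im z \<le> b})"
        by (intro convex_Int convex_halfspace_Im_ge convex_halfspace_Im_le convex_halfspace_Re_ge convex_halfspace_Re_le)
      then have "closed_segment (Complex u p) (Complex u q) \<subseteq> {z. u \<le> Re z} \<inter> {z. Re z \<le> u} \<inter> {z. a \<le> Im z} \<inter> {z. Im z \<le> b}"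
        using that by (intro closed_segment_subset) auto
      from subsetD[OF this that(1)] show ?thesis by auto
    qed
    have ci_h: "f contour_integrable_on linepath (Complex u h) (Complex v h)" if "h = a \<or> h = b" for u v h
      by (rule contour_integrable_continuous_linepath, rule continuous_on_subset[OF cont])
         (use seg_h[of u h v] that in auto)
    have ci_v: "f contour_integrable_on linepath (Complex u p) (Complex u q)"
      if "a \<le> p" "p \<le> b" "a \<le> q" "q \<le> b" "\<bar>u\<bar> = R" for u p q
      by (rule contour_integrable_continuous_linepath, rule continuous_on_subset[OF cont])
         (use seg_v[of _ u p q] that R in auto)
    have hor: "contour_integral (linepath (Complex (-R) h) (Complex R h)) f = ?I h R"
      if "a \<le> h" "h \<le> b" "integrable lborel (\<lambda>x. f (Complex x h))" for h
    proof -
      have "set_integrable lborel {-R..R} (\<lambda>x. f (Complex x h))"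
        unfolding set_integrable_def using that(3) by (rule integrable_mult_indicator[rotated]) auto
      from set_borel_integral_eq_integral[OF this]
      have "((\<lambda>x. f (Complex x h)) has_integral ?I h R) {-R..R}"
        by (simp add: has_integral_iff)
      then show ?thesis using R
        by (intro contour_integral_unique) (simp add: has_contour_integral_linepath_horizontal)
    qed
    have ver: "norm (contour_integral (linepath (Complex u p) (Complex u q)) f) \<le> B u * \<bar>q - p\<bar>"
      if "a \<le> p" "p \<le> b" "a \<le> q" "q \<le> b" "\<bar>u\<bar> = R" for u p q
    proof -
      have bd: "norm (f z) \<le> B u" if z: "z \<in> closed_segment (Complex u p) (Complex u q)" for z
        using seg_v[OF z] \<open>a \<le> p\<close> \<open>p \<le> b\<close> \<open>a \<le> q\<close> \<open>q \<le> b\<close> bound[of z] R \<open>\<bar>u\<bar> = R\<close> by auto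
      have "B u \<ge> 0" using order_trans[OF norm_ge_zero bd[of "Complex u p"]] by simp
      then have "norm (contour_integral (linepath (Complex u p) (Complex u q)) f) \<le> B u * norm (Complex u q - Complex u p)"
        using that bd by (intro contour_integral_bound_linepath ci_v) auto
      also have "norm (Complex u q - Complex u p) = \<bar>q - p\<bar>" by (simp add: cmod_def)
      finally show ?thesis .
    qed
    have "c = contour_integral (linepath (Complex (-R) a) (Complex R a)) f
      + (contour_integral (linepath (Complex R a) (Complex R b)) f
      + (contour_integral (linepath (Complex R b) (Complex (-R) b)) f
      + contour_integral (linepath (Complex (-R) b) (Complex (-R) a)) f))"
      unfolding cR[symmetric] rectpath_def Let_def
      using ab R by (simp add: contour_integrable_joinI ci_h ci_v)
    moreover have "contour_integral (linepath (Complex R b) (Complex (-R) b)) f = - ?I b R"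
      using hor[of b] ib ab contour_integral_reversepath[of "linepath (Complex (-R) b) (Complex R b)" f] by simp
    ultimately have "c - (?I a R - ?I b R) = contour_integral (linepath (Complex R a) (Complex R b)) f
        + contour_integral (linepath (Complex (-R) b) (Complex (-R) a)) f"
      using hor[of a] ia ab by simp
    also have "norm \<dots> \<le> B R * \<bar>b - a\<bar> + B (-R) * \<bar>a - b\<bar>"
      using ab R by (intro norm_triangle_mono ver) auto
    finally show ?thesis using ab by (simp add: algebra_simps)
  qed
  have "((\<lambda>R. c - (?I a R - ?I b R)) \<longlongrightarrow> 0) at_top"
  proof (rule Lim_null_comparison)
    show "\<forall>\<^sub>F R in at_top. norm (c - (?I a R - ?I b R)) \<le> (B R + B (-R)) * (b - a)"
      using c eventually_ge_at_top[of "max 1 \<rho>"] by eventually_elim (rule bnd)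
    have "((\<lambda>R. B (-R)) \<longlongrightarrow> 0) at_top"
      using B(2) filterlim_uminus_at_bot_at_top by (rule filterlim_compose)
    then show "((\<lambda>R. (B R + B (-R)) * (b - a)) \<longlongrightarrow> 0) at_top"
      using B(1) by (auto intro!: tendsto_eq_intros)
  qed
  moreover have "((\<lambda>R. c - (?I a R - ?I b R)) \<longlongrightarrow>
     c - ((LINT x|lborel. f (Complex x a)) - (LINT x|lborel. f (Complex x b)))) at_top"
    by (intro tendsto_intros lim ia ib)
  ultimately have "0 = c - ((LINT x|lborel. f (Complex x a)) - (LINT x|lborel. f (Complex x b)))"
    by (rule tendsto_unique[rotated]) simp
  then show ?thesis by simp
qed

section \<open>Nonnegativity of the kernel\<close>

text \<open>With Y = y e^(\<beta> Re w) the squared modulus is 1 + 2 Y cos(\<beta> Im w) + Y^2. In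
  the strip |\<beta> Im w| \<le> pi \<beta> < pi, so the cosine is smallest on the edges, where the
  value is \<open>kden \<beta> Y\<close>.\<close>

lemma one_plus_exp_norm:
  assumes "0 < \<beta>" "\<beta> < 1" "y \<ge> 0" "\<bar>Im w\<bar> \<le> pi"
  shows "(norm (1 + of_real y * exp (of_real \<beta> * w)))\<^sup>2 \<ge> kconst \<beta> * (1 + y * exp (\<beta> * Re w))\<^sup>2"
proof -
  let ?Y = "y * exp (\<beta> * Re w)"
  have Y: "?Y \<ge> 0" using assms by simp
  have "cos (pi * \<beta>) \<le> cos (\<bar>\<beta> * Im w\<bar>)"
    using assms by (intro cos_monotone_0_pi_le) (auto simp: abs_mult mult.commute mult_left_le)
  then have cos: "cos (pi * \<beta>) \<le> cos (\<beta> * Im w)" by simp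
  have "(norm (1 + of_real y * exp (of_real \<beta> * w)))\<^sup>2 = (1 + ?Y * cos (\<beta> * Im w))\<^sup>2 + (?Y * sin (\<beta> * Im w))\<^sup>2"
    unfolding cmod_power2 by (simp add: Re_exp Im_exp mult.assoc)
  also have "\<dots> = 1 + 2 * cos (\<beta> * Im w) * ?Y + ?Y\<^sup>2 * ((sin (\<beta> * Im w))\<^sup>2 + (cos (\<beta> * Im w))\<^sup>2)"
    by algebra
  also have "\<dots> = 1 + 2 * cos (\<beta> * Im w) * ?Y + ?Y\<^sup>2" by simp
  also have "\<dots> \<ge> kden \<beta> ?Y"
    unfolding kden_def using mult_right_mono[OF cos Y] by simp
  finally show ?thesis using kden_ge[of \<beta> ?Y] by linarith
qed

lemma one_plus_exp_nonzero:
  assumes "0 < \<beta>" "\<beta> < 1" "y \<ge> 0" "\<bar>Im w\<bar> \<le> pi"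
  shows "1 + of_real y * exp (of_real \<beta> * w) \<noteq> (0::complex)"
proof -
  have "1 + y * exp (\<beta> * Re w) > 0" using assms by (simp add: add_pos_nonneg)
  then have "kconst \<beta> * (1 + y * exp (\<beta> * Re w))\<^sup>2 > 0" using kconst_pos[of \<beta>] assms by simp
  then show ?thesis using one_plus_exp_norm[OF assms] by auto
qed

text \<open>The branch of \<open>z powr \<gamma>\<close> cut along the negative imaginary axis: it agrees with the
  principal branch on the closed upper half-plane and is continuous at both real half-axes.\<close>

definition upper_powr :: "real \<Rightarrow> complex \<Rightarrow> complex" where
  "upper_powr \<gamma> z = exp (of_real \<gamma> * (Ln (- \<i> * z) + \<i> * pi / 2))"

text \<open>For Im z \<ge> 0 the number \<open>- \<i> * z\<close> lies in the closed right
  half-plane, so multiplying it by \<open>\<i>\<close> adds pi/2 to its argument without crossing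
  the principal cut.\<close>

lemma upper_powr_eq:
  assumes "z \<noteq> 0" "Im z \<ge> 0"
  shows "upper_powr \<gamma> z = exp (of_real \<gamma> * Ln z)"
proof -
  have "Ln (\<i> * (- \<i> * z)) = Ln (- \<i> * z) + \<i> * of_real pi / 2"
    using assms by (subst Ln_times_ii) auto
  then show ?thesis by (simp add: upper_powr_def)
qed

lemma norm_upper_powr:
  assumes "z \<noteq> 0" shows "norm (upper_powr \<gamma> z) = norm z powr \<gamma>"
  using assms by (simp add: upper_powr_def norm_exp_eq_Re norm_mult powr_def)

text \<open>The integrand of the rotation argument after \<open>z = t * exp w\<close>, with \<open>y = t powr \<beta>\<close> and a
  positive power of \<open>t\<close> removed.\<close>

definition rot_integrand :: "real \<Rightarrow> real \<Rightarrow> complex \<Rightarrow> complex" where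
  "rot_integrand \<beta> y w = exp w * upper_powr (\<beta> - 1) (exp w + 1) / (1 + of_real y * exp (of_real \<beta> * w))\<^sup>2"

text \<open>The strip reaches below the real axis so that the line Im w = 0 is interior to the
  domain of holomorphy. The excluded point \<open>\<i> * pi\<close> is the branch point, where exp w
  + 1 vanishes.\<close>

lemma rot_integrand_domain:
  assumes "- pi / 2 < Im w" "Im w \<le> pi" "w \<noteq> \<i> * pi"
  shows "- \<i> * (exp w + 1) \<notin> \<real>\<^sub>\<le>\<^sub>0"
proof
  assume "- \<i> * (exp w + 1) \<in> \<real>\<^sub>\<le>\<^sub>0"
  then have *: "Re (exp w + 1) = 0" "Im (exp w) \<le> 0"
    by (auto simp: complex_nonpos_Reals_iff)
  consider "Im w \<le> 0" | "0 < Im w" "Im w < pi" | "Im w = pi" using assms by linarith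
  then show False
  proof cases
    case 1
    then have "cos (Im w) \<ge> 0" using assms by (intro cos_ge_zero) auto
    then have "Re (exp w) \<ge> 0" by (simp add: Re_exp)
    then show ?thesis using * by simp
  next
    case 2
    then have "sin (Im w) > 0" by (intro sin_gt_zero)
    then have "Im (exp w) > 0" by (simp add: Im_exp)
    then show ?thesis using * by simp
  next
    case 3
    then have "exp (Re w) = 1" using * by (simp add: Re_exp)
    then have "w = \<i> * pi" using 3 by (simp add: complex_eq_iff)
    then show ?thesis using assms by simp
  qed
qed

lemma exp_plus_one_norm: "norm (exp w + 1) \<ge> \<bar>exp (Re w) - 1\<bar>"
  using norm_triangle_ineq3[of "exp w" "-1"] by (simp add: norm_exp_eq_Re)

text \<open>As \<beta> - 1 < 0, the lower bound |exp w + 1| \<ge> |exp (Re w) - 1| gives an upper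
  bound for the power that does not involve Im w. The same dominating function therefore works at
  every height of the strip, including the edge.\<close>

lemma rot_integrand_bound:
  assumes "0 < \<beta>" "\<beta> < 1" "y \<ge> 0" "0 \<le> Im w" "Im w \<le> pi" "Re w \<noteq> 0"
  shows "norm (rot_integrand \<beta> y w) \<le> exp (Re w) * (\<bar>exp (Re w) - 1\<bar> powr (\<beta> - 1) / (kconst \<beta> * (1 + y * exp (Re w) powr \<beta>)\<^sup>2))"
proof -
  have p: "\<bar>exp (Re w) - 1\<bar> > 0" using assms by auto
  then have nz: "exp w + 1 \<noteq> 0" using exp_plus_one_norm[of w] by auto
  have e: "exp (\<beta> * Re w) = exp (Re w) powr \<beta>" by (simp add: exp_powr_real mult.commute)
  have "1 + y * exp (\<beta> * Re w) > 0" using assms by (simp add: add_pos_nonneg)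
  then have lp: "kconst \<beta> * (1 + y * exp (\<beta> * Re w))\<^sup>2 > 0" using kconst_pos[of \<beta>] assms by simp
  have "norm (rot_integrand \<beta> y w) = exp (Re w) * norm (exp w + 1) powr (\<beta> - 1) /
     (norm (1 + of_real y * exp (of_real \<beta> * w)))\<^sup>2"
    using norm_upper_powr[OF nz] by (simp add: rot_integrand_def norm_mult norm_divide norm_power norm_exp_eq_Re)
  also have "\<dots> \<le> exp (Re w) * \<bar>exp (Re w) - 1\<bar> powr (\<beta> - 1) / (kconst \<beta> * (1 + y * exp (\<beta> * Re w))\<^sup>2)"
    using assms p lp one_plus_exp_norm[of \<beta> y w] exp_plus_one_norm[of w]
    by (intro frac_le mult_left_mono powr_mono2') auto
  finally show ?thesis unfolding e by simp
qed

text \<open>For y \<ge> 1 the factor y in the denominator can be lowered to 1, which leaves the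
  half-axis kernel with the singularity at x = 1.\<close>

lemma rot_integrand_dominator_integrable:
  assumes "0 < \<beta>" "\<beta> < 1" "y \<ge> 1"
  shows "integrable lborel (\<lambda>v. exp v * (\<bar>exp v - 1\<bar> powr (\<beta> - 1) / (kconst \<beta> * (1 + y * exp v powr \<beta>)\<^sup>2)))"
proof -
  have "set_integrable lborel {0<..} (\<lambda>x. \<bar>x - 1\<bar> powr (\<beta> - 1) / (kconst \<beta> * (1 + y * x powr \<beta>)\<^sup>2))"
  proof (rule set_integrable_bound)
    show "set_integrable lborel {0<..} (\<lambda>x. 1 / kconst \<beta> * (\<bar>x - 1\<bar> powr (\<beta> - 1) / (1 + x powr \<beta>)\<^sup>2))"
      by (intro set_integrable_mult_right abs_powr_kernel_integrable assms)
    show "AE x in lborel. x \<in> {0<..} \<longrightarrow>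
       norm (\<bar>x - 1\<bar> powr (\<beta> - 1) / (kconst \<beta> * (1 + y * x powr \<beta>)\<^sup>2))
       \<le> norm (1 / kconst \<beta> * (\<bar>x - 1\<bar> powr (\<beta> - 1) / (1 + x powr \<beta>)\<^sup>2))"
    proof (intro AE_I2 impI)
      fix x :: real assume "x \<in> {0<..}"
      have l: "kconst \<beta> > 0" using kconst_pos assms by auto
      have "1 * x powr \<beta> \<le> y * x powr \<beta>" using assms by (intro mult_right_mono) auto
      then have "(1 + x powr \<beta>)\<^sup>2 \<le> (1 + y * x powr \<beta>)\<^sup>2" by (intro power_mono) auto
      moreover have "0 < 1 + x powr \<beta>" by (simp add: add_pos_nonneg)
      ultimately have "\<bar>x - 1\<bar> powr (\<beta> - 1) / (kconst \<beta> * (1 + y * x powr \<beta>)\<^sup>2)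
          \<le> \<bar>x - 1\<bar> powr (\<beta> - 1) / (kconst \<beta> * (1 + x powr \<beta>)\<^sup>2)"
        using l by (intro divide_left_mono mult_left_mono mult_pos_pos) (auto simp: add_nonneg_eq_0_iff)
      then show "norm (\<bar>x - 1\<bar> powr (\<beta> - 1) / (kconst \<beta> * (1 + y * x powr \<beta>)\<^sup>2))
       \<le> norm (1 / kconst \<beta> * (\<bar>x - 1\<bar> powr (\<beta> - 1) / (1 + x powr \<beta>)\<^sup>2))"
        using l by simp
    qed
  qed (auto simp: set_borel_measurable_def)
  then show ?thesis
    by (subst exp_substitution(1)) auto
qed

lemma rot_integrand_dominator_tendsto:
  assumes "0 < \<beta>" "\<beta> < 1" "y \<ge> 1"
  defines "B \<equiv> \<lambda>v. exp v * (\<bar>exp v - 1\<bar> powr (\<beta> - 1) / (kconst \<beta> * (1 + y * exp v powr \<beta>)\<^sup>2))"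
  shows "(B \<longlongrightarrow> 0) at_top" "(B \<longlongrightarrow> 0) at_bot"
proof -
  define g where "g = (\<lambda>x. x * (\<bar>x - 1\<bar> powr (\<beta> - 1) / (kconst \<beta> * (1 + y * x powr \<beta>)\<^sup>2)))"
  have B: "B = (\<lambda>v. g (exp v))" by (simp add: B_def g_def)
  have l: "kconst \<beta> > 0" using kconst_pos assms by auto
  have "(g \<longlongrightarrow> 0 * (\<bar>0 - 1\<bar> powr (\<beta> - 1) / (kconst \<beta> * (1 + y * 0)\<^sup>2))) (at_right 0)"
    unfolding g_def using l assms
    by (intro tendsto_intros) (auto intro!: tendsto_eq_intros simp: eventually_at_right_less eventually_at_filter)
  then have "(g \<longlongrightarrow> 0) (at_right 0)" by simp
  moreover have "filterlim (exp :: real \<Rightarrow> real) (at_right 0) at_bot" by real_asymp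
  ultimately show "(B \<longlongrightarrow> 0) at_bot" unfolding B by (rule filterlim_compose)
  have "(g \<longlongrightarrow> 0) at_top"
  proof (rule Lim_null_comparison)
    \<comment> \<open>For x \<ge> 2 one has |x - 1| \<ge> x/2, and the exponents add up to 1 +
      (\<beta> - 1) - 2 \<beta> = -\<beta>.\<close>
    show "\<forall>\<^sub>F x in at_top. norm (g x) \<le> (2 powr (1 - \<beta>) / kconst \<beta>) * x powr (-\<beta>)"
      using eventually_ge_at_top[of 2]
    proof eventually_elim
      fix x :: real assume x: "x \<ge> 2"
      have "x powr \<beta> \<le> y * x powr \<beta>" using assms mult_right_mono[of 1 y "x powr \<beta>"] by simp
      then have d: "kconst \<beta> * (x powr \<beta>)\<^sup>2 \<le> kconst \<beta> * (1 + y * x powr \<beta>)\<^sup>2"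
        using l by (intro mult_left_mono power_mono) auto
      have "\<bar>x - 1\<bar> powr (\<beta> - 1) \<le> (x / 2) powr (\<beta> - 1)"
        using x assms by (intro powr_mono2') auto
      then have "norm (g x) \<le> x * ((x / 2) powr (\<beta> - 1) / (kconst \<beta> * (x powr \<beta>)\<^sup>2))"
        unfolding g_def using x l d by (auto simp: abs_mult intro!: mult_left_mono frac_le)
      also have "(x / 2) powr (\<beta> - 1) = x powr (\<beta> - 1) * 2 powr (1 - \<beta>)"
        using x by (simp add: powr_divide powr_minus_divide[of 2 "1-\<beta>", simplified])
      also have "x * (x powr (\<beta> - 1) * 2 powr (1 - \<beta>) / (kconst \<beta> * (x powr \<beta>)\<^sup>2)) =
         (2 powr (1 - \<beta>) / kconst \<beta>) * x powr (-\<beta>)"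
      proof -
        have "x * x powr (\<beta> - 1) = x powr \<beta>" using x by (simp add: powr_mult_base)
        moreover have "x powr \<beta> / (x powr \<beta>)\<^sup>2 = x powr (-\<beta>)"
          using x by (simp add: powr_minus_divide power2_eq_square)
        moreover have "x * (x powr (\<beta> - 1) * 2 powr (1 - \<beta>) / (kconst \<beta> * (x powr \<beta>)\<^sup>2)) =
            (2 powr (1 - \<beta>) / kconst \<beta>) * ((x * x powr (\<beta> - 1)) / (x powr \<beta>)\<^sup>2)" by simp
        ultimately show ?thesis by simp
      qed
      finally show "norm (g x) \<le> (2 powr (1 - \<beta>) / kconst \<beta>) * x powr (-\<beta>)" .
    qed
    have "((\<lambda>x::real. x powr (-\<beta>)) \<longlongrightarrow> 0) at_top"
      using assms by (intro tendsto_neg_powr filterlim_ident) auto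
    then show "((\<lambda>x. (2 powr (1 - \<beta>) / kconst \<beta>) * x powr (-\<beta>)) \<longlongrightarrow> 0) at_top"
      by (rule tendsto_mult_right_zero)
  qed
  then show "(B \<longlongrightarrow> 0) at_top" unfolding B using exp_at_top by (rule filterlim_compose)
qed

lemma rot_integrand_isCont:
  assumes "0 < \<beta>" "\<beta> < 1" "y \<ge> 0" "- pi / 2 < Im w" "Im w \<le> pi" "w \<noteq> \<i> * pi"
  shows "isCont (rot_integrand \<beta> y) w"
  using rot_integrand_domain[OF assms(4-6)] one_plus_exp_nonzero[of \<beta> y w] assms
  unfolding rot_integrand_def upper_powr_def by (intro continuous_intros) auto

lemma rot_integrand_holomorphic:
  assumes "0 < \<beta>" "\<beta> < 1" "y \<ge> 0"
  shows "rot_integrand \<beta> y holomorphic_on {w. - pi / 2 < Im w \<and> Im w < pi}"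
proof -
  have "w \<noteq> \<i> * pi" if "Im w < pi" for w using that by auto
  then show ?thesis
  using rot_integrand_domain one_plus_exp_nonzero[of \<beta> y] assms
  unfolding rot_integrand_def upper_powr_def by (intro holomorphic_intros) (auto simp: less_imp_le)
qed

lemma rot_integrand_line_integrable:
  assumes "0 < \<beta>" "\<beta> < 1" "y \<ge> 1" "0 \<le> h" "h < pi"
  shows "integrable lborel (\<lambda>x. rot_integrand \<beta> y (Complex x h))"
proof (rule Bochner_Integration.integrable_bound[OF rot_integrand_dominator_integrable])
  have "continuous_on UNIV (\<lambda>x. rot_integrand \<beta> y (Complex x h))"
  proof (intro continuous_at_imp_continuous_on ballI)
    fix x :: real
    have "isCont (\<lambda>x. of_real x + \<i> * of_real h) x" by (intro continuous_intros)
    then have "isCont (\<lambda>x. Complex x h) x" by (simp add: Complex_eq)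
    moreover have "isCont (rot_integrand \<beta> y) (Complex x h)"
      using assms by (intro rot_integrand_isCont) (auto simp: complex_eq_iff)
    ultimately show "isCont (\<lambda>x. rot_integrand \<beta> y (Complex x h)) x" by (rule isCont_o2)
  qed
  then show "(\<lambda>x. rot_integrand \<beta> y (Complex x h)) \<in> borel_measurable lborel"
    by (simp add: borel_measurable_continuous_onI)
  show "AE x in lborel. norm (rot_integrand \<beta> y (Complex x h)) \<le>
     norm (exp x * (\<bar>exp x - 1\<bar> powr (\<beta> - 1) / (kconst \<beta> * (1 + y * exp x powr \<beta>)\<^sup>2)))"
    using AE_lborel_singleton[of "0::real"]
  proof eventually_elim
    fix x :: real assume "x \<noteq> 0"
    then show "norm (rot_integrand \<beta> y (Complex x h)) \<le>
     norm (exp x * (\<bar>exp x - 1\<bar> powr (\<beta> - 1) / (kconst \<beta> * (1 + y * exp x powr \<beta>)\<^sup>2)))"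
      using rot_integrand_bound[of \<beta> y "Complex x h"] assms unfolding real_norm_def
      by (intro order_trans[OF _ abs_ge_self]) simp
  qed
qed (use assms in auto)

text \<open>The rectangle lies in a convex domain of holomorphy, so Cauchy's theorem makes the
  contour constant 0. The height stays below pi to keep away from the branch point.\<close>

lemma rot_integrand_line_shift:
  assumes "0 < \<beta>" "\<beta> < 1" "y \<ge> 1" "0 < h" "h < pi"
  shows "(LINT x|lborel. rot_integrand \<beta> y (Complex x 0)) = (LINT x|lborel. rot_integrand \<beta> y (Complex x h))"
proof -
  have holo: "rot_integrand \<beta> y holomorphic_on {w. - pi / 2 < Im w \<and> Im w < pi}"
    using assms by (intro rot_integrand_holomorphic) auto
  have "(LINT x|lborel. rot_integrand \<beta> y (Complex x 0)) - (LINT x|lborel. rot_integrand \<beta> y (Complex x h)) = 0"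
  proof (rule strip_contour[OF assms(4) _ _ _ _ rot_integrand_dominator_tendsto[OF assms(1-3)]])
    have "- pi / 2 < 0" by simp
    then show "continuous_on {z. Im z = 0 \<or> Im z = h \<or> (0 \<le> Im z \<and> Im z \<le> h \<and> 1 \<le> \<bar>Re z\<bar>)} (rot_integrand \<beta> y)"
      using assms by (intro holomorphic_on_imp_continuous_on holomorphic_on_subset[OF holo]) auto
    show "\<forall>\<^sub>F R in at_top. contour_integral (rectpath (Complex (-R) 0) (Complex R h)) (rot_integrand \<beta> y) = 0"
      using eventually_ge_at_top[of 1]
    proof eventually_elim
      fix R :: real assume R: "R \<ge> 1"
      show "contour_integral (rectpath (Complex (-R) 0) (Complex R h)) (rot_integrand \<beta> y) = 0"
      proof (rule contour_integral_unique, rule Cauchy_theorem_convex_simple[OF holo])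
        have "convex ({w. - pi / 2 < Im w} \<inter> {w. Im w < pi})"
          by (intro convex_Int convex_halfspace_Im_gt convex_halfspace_Im_lt)
        then show "convex {w. - pi / 2 < Im w \<and> Im w < pi}" by (simp add: Collect_conj_eq)
        show "path_image (rectpath (Complex (-R) 0) (Complex R h)) \<subseteq> {w. - pi / 2 < Im w \<and> Im w < pi}"
          using R assms \<open>- pi / 2 < 0\<close>
          by (intro order_trans[OF path_image_rectpath_subset_cbox]) (auto simp: in_cbox_complex_iff)
      qed auto
    qed
    fix z :: complex assume "0 \<le> Im z" "Im z \<le> h" "1 \<le> \<bar>Re z\<bar>"
    then show "norm (rot_integrand \<beta> y z) \<le> exp (Re z) * (\<bar>exp (Re z) - 1\<bar> powr (\<beta> - 1) / (kconst \<beta> * (1 + y * exp (Re z) powr \<beta>)\<^sup>2))"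
      using assms by (intro rot_integrand_bound) auto
  qed (use assms in \<open>auto intro!: rot_integrand_line_integrable\<close>)
  then show ?thesis by simp
qed

text \<open>The lines at height \<open>h n\<close> all carry the same integral as the real line,
  where the integrand is real. Dominated convergence takes this to the edge Im w = pi, although the
  integrand is singular there at x = 0.\<close>

lemma rot_integrand_boundary:
  assumes "0 < \<beta>" "\<beta> < 1" "y \<ge> 1"
  shows "integrable lborel (\<lambda>x. rot_integrand \<beta> y (Complex x pi))"
    and "(LINT x|lborel. Im (rot_integrand \<beta> y (Complex x pi))) = 0"
proof -
  define h where "h = (\<lambda>n. pi - 1 / real (Suc n))"
  have h: "0 < h n" "h n < pi" for n
  proof -
    have "1 / real (Suc n) \<le> 1" by simp
    then show "0 < h n" using pi_gt3 unfolding h_def by linarith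
    show "h n < pi" by (simp add: h_def)
  qed
  have hlim: "h \<longlonglongrightarrow> pi" unfolding h_def by real_asymp
  have nz: "isCont (rot_integrand \<beta> y) (Complex x pi)" if "x \<noteq> 0" for x
  proof (rule rot_integrand_isCont)
    have "- pi / 2 < 0" by simp
    then show "- pi / 2 < Im (Complex x pi)" using pi_gt_zero unfolding complex.sel by linarith
  qed (use that assms in \<open>auto simp: complex_eq_iff\<close>)
  have lim: "(\<lambda>n. rot_integrand \<beta> y (Complex x (h n))) \<longlonglongrightarrow> rot_integrand \<beta> y (Complex x pi)" if "x \<noteq> 0" for x
  proof -
    have "(\<lambda>n. of_real x + \<i> * of_real (h n)) \<longlonglongrightarrow> of_real x + \<i> * of_real pi"
      by (intro tendsto_intros hlim)
    then have "(\<lambda>n. Complex x (h n)) \<longlonglongrightarrow> Complex x pi" by (simp add: Complex_eq)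
    then show ?thesis by (rule isCont_tendsto_compose[OF nz[OF that]])
  qed
  \<comment> \<open>Continuity on the edge fails at x = 0, so measurability is obtained on the
    complement of that point and the single value is added back.\<close>
  have meas [measurable]: "(\<lambda>x. rot_integrand \<beta> y (Complex x pi)) \<in> borel_measurable borel"
  proof -
    have [measurable]: "(\<lambda>x. indicator (-{0}) x *\<^sub>R rot_integrand \<beta> y (Complex x pi)) \<in> borel_measurable borel"
    proof (rule borel_measurable_continuous_on_indicator)
      show "continuous_on (- {0}) (\<lambda>x. rot_integrand \<beta> y (Complex x pi))"
      proof (intro continuous_at_imp_continuous_on ballI)
        fix x :: real assume "x \<in> - {0}"
        then have "isCont (rot_integrand \<beta> y) (Complex x pi)" by (intro nz) auto
        moreover have "isCont (\<lambda>x. of_real x + \<i> * of_real pi) x" by (intro continuous_intros)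
        then have "isCont (\<lambda>x. Complex x pi) x" by (simp add: Complex_eq)
        ultimately show "isCont (\<lambda>x. rot_integrand \<beta> y (Complex x pi)) x" by (rule isCont_o2[rotated])
      qed
    qed auto
    have "(\<lambda>x. rot_integrand \<beta> y (Complex x pi)) = (\<lambda>x. indicator (-{0}) x *\<^sub>R rot_integrand \<beta> y (Complex x pi) +
        indicator {0} x *\<^sub>R rot_integrand \<beta> y (Complex 0 pi))"
      by (auto simp: indicator_def)
    also have "\<dots> \<in> borel_measurable borel" by measurable
    finally show ?thesis .
  qed
  have hmeas: "(\<lambda>x. rot_integrand \<beta> y (Complex x (h n))) \<in> borel_measurable lborel" for n
    using rot_integrand_line_integrable[of \<beta> y "h n"] assms h[of n] by (auto simp: borel_measurable_integrable)
  have AElim: "AE x in lborel. (\<lambda>n. rot_integrand \<beta> y (Complex x (h n))) \<longlonglongrightarrow> rot_integrand \<beta> y (Complex x pi)"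
    using AE_lborel_singleton[of "0::real"] by eventually_elim (rule lim)
  have AEb: "AE x in lborel. norm (rot_integrand \<beta> y (Complex x (h n))) \<le>
    exp x * (\<bar>exp x - 1\<bar> powr (\<beta> - 1) / (kconst \<beta> * (1 + y * exp x powr \<beta>)\<^sup>2))" for n
    using AE_lborel_singleton[of "0::real"]
  proof eventually_elim
    fix x :: real assume "x \<noteq> 0"
    then show "norm (rot_integrand \<beta> y (Complex x (h n))) \<le>
    exp x * (\<bar>exp x - 1\<bar> powr (\<beta> - 1) / (kconst \<beta> * (1 + y * exp x powr \<beta>)\<^sup>2))"
      using rot_integrand_bound[of \<beta> y "Complex x (h n)"] assms h[of n] by simp
  qed
  have meas': "(\<lambda>x. rot_integrand \<beta> y (Complex x pi)) \<in> borel_measurable lborel" using meas by simp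
  note dct = meas' hmeas rot_integrand_dominator_integrable[OF assms] AElim AEb
  show int: "integrable lborel (\<lambda>x. rot_integrand \<beta> y (Complex x pi))"
    by (rule integrable_dominated_convergence[OF dct])
  have "(\<lambda>n. LINT x|lborel. rot_integrand \<beta> y (Complex x (h n))) \<longlonglongrightarrow> (LINT x|lborel. rot_integrand \<beta> y (Complex x pi))"
    by (rule integral_dominated_convergence[OF dct])
  moreover have "(LINT x|lborel. rot_integrand \<beta> y (Complex x (h n))) = (LINT x|lborel. rot_integrand \<beta> y (Complex x 0))" for n
    using rot_integrand_line_shift[of \<beta> y "h n"] assms h[of n] by simp
  ultimately have eq: "(LINT x|lborel. rot_integrand \<beta> y (Complex x pi)) = (LINT x|lborel. rot_integrand \<beta> y (Complex x 0))"
    by (simp add: LIMSEQ_const_iff)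
  have "Im (rot_integrand \<beta> y (Complex x 0)) = 0" for x
  proof -
    have c: "Complex x 0 = of_real x" by (simp add: complex_eq_iff)
    have p: "exp x + 1 > 0" by (simp add: add_pos_pos)
    have "upper_powr (\<beta> - 1) (of_real (exp x + 1)) = exp (of_real (\<beta> - 1) * Ln (of_real (exp x + 1)))"
    proof (rule upper_powr_eq)
      show "complex_of_real (exp x + 1) \<noteq> 0" using p by (metis of_real_eq_0_iff less_irrefl)
      show "0 \<le> Im (complex_of_real (exp x + 1))" by (simp only: Im_complex_of_real order_refl)
    qed
    also have "\<dots> = exp (of_real ((\<beta> - 1) * ln (exp x + 1)))"
      using p by (simp only: Ln_of_real of_real_mult)
    also have "\<dots> = of_real (exp ((\<beta> - 1) * ln (exp x + 1)))"
      by (simp only: exp_of_real)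
    finally have u: "upper_powr (\<beta> - 1) (of_real (exp x + 1)) = of_real (exp ((\<beta> - 1) * ln (exp x + 1)))" .
    have e: "exp (complex_of_real x) = of_real (exp x)"
      "exp (of_real \<beta> * complex_of_real x) = of_real (exp (\<beta> * x))"
      by (simp_all only: exp_of_real flip: of_real_mult)
    have e': "complex_of_real (exp x) + 1 = of_real (exp x + 1)" by (simp only: of_real_add of_real_1)
    have "rot_integrand \<beta> y (Complex x 0) = of_real (exp x * exp ((\<beta> - 1) * ln (exp x + 1)) / (1 + y * exp (\<beta> * x))\<^sup>2)"
      unfolding rot_integrand_def c e e' u by (simp only: of_real_mult of_real_divide of_real_add of_real_power of_real_1)
    then show ?thesis by (simp only: Im_complex_of_real)
  qed
  then have "Im (LINT x|lborel. rot_integrand \<beta> y (Complex x 0)) = 0"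
    using rot_integrand_line_integrable[of \<beta> y 0] assms by (subst integral_Im[symmetric]) auto
  then show "(LINT x|lborel. Im (rot_integrand \<beta> y (Complex x pi))) = 0"
    using int eq by (subst integral_Im) auto
qed

text \<open>On the edge exp w is negative and z^\<beta> has phase e^(i pi \<beta>). Multiplying by
  the conjugate of 1 + Y e^(i pi \<beta>) makes the denominator real, namely the square of
  \<open>kden \<beta> Y\<close>.\<close>

lemma rot_integrand_boundary_eq:
  assumes "0 < \<beta>" "\<beta> < 1" "y \<ge> 0" "v \<noteq> 0"
  defines "Y \<equiv> y * exp v powr \<beta>"
  shows "rot_integrand \<beta> y (Complex v pi) = - of_real (exp v / (kden \<beta> Y)\<^sup>2) * upper_powr (\<beta> - 1) (of_real (1 - exp v)) *
     (Complex (1 + cos (pi * \<beta>) * Y) (- sin (pi * \<beta>) * Y))\<^sup>2"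
proof -
  let ?q = "Complex (1 + cos (pi * \<beta>) * Y) (sin (pi * \<beta>) * Y)"
  let ?p = "Complex (1 + cos (pi * \<beta>) * Y) (- sin (pi * \<beta>) * Y)"
  have Y: "Y = y * exp (\<beta> * v)" by (simp add: Y_def exp_powr_real mult.commute)
  have Y0: "Y \<ge> 0" using assms by (simp add: Y_def)
  have d: "kden \<beta> Y > 0" using kden_pos assms Y0 by auto
  have e: "exp (Complex v pi) = - of_real (exp v)"
    by (simp add: complex_eq_iff Re_exp Im_exp)
  have q: "1 + of_real y * exp (of_real \<beta> * Complex v pi) = ?q"
    by (simp add: complex_eq_iff Re_exp Im_exp Y mult_ac)
  have "(sin (pi * \<beta>))\<^sup>2 + (cos (pi * \<beta>))\<^sup>2 = 1" by simp
  then have "(1 + cos (pi * \<beta>) * Y) * (1 + cos (pi * \<beta>) * Y) + (sin (pi * \<beta>) * Y) * (sin (pi * \<beta>) * Y)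
      = Y\<^sup>2 + 2 * cos (pi * \<beta>) * Y + 1" by algebra
  then have qp: "?q * ?p = of_real (kden \<beta> Y)"
    by (simp add: complex_eq_iff kden_def)
  then have nz: "?q \<noteq> 0" "?p \<noteq> 0" using d by auto
  have "1 / ?q\<^sup>2 = ?p\<^sup>2 / (?q * ?p)\<^sup>2"
    using nz by (simp add: power_mult_distrib)
  also have "\<dots> = ?p\<^sup>2 / of_real ((kden \<beta> Y)\<^sup>2)" unfolding qp by simp
  finally have inv: "1 / ?q\<^sup>2 = ?p\<^sup>2 / of_real ((kden \<beta> Y)\<^sup>2)" .
  have z: "- of_real (exp v) + 1 = complex_of_real (1 - exp v)" by simp
  have "rot_integrand \<beta> y (Complex v pi) = - of_real (exp v) * upper_powr (\<beta> - 1) (of_real (1 - exp v)) * (1 / ?q\<^sup>2)"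
    unfolding rot_integrand_def e q z by simp
  then show ?thesis unfolding inv by simp
qed

text \<open>For v < 0 the base 1 - e^v is positive and its power is real, so the phase comes only
  from (1 + Y e^(-i pi \<beta>))^2, whose imaginary part is -2 sin(pi \<beta>) Y (1 + cos(pi
  \<beta>) Y). This is the integrand of \<open>phi_beta\<close> at r = e^v.\<close>

lemma rot_integrand_Im_neg:
  assumes "0 < \<beta>" "\<beta> < 1" "y \<ge> 0" "v < 0"
  shows "Im (rot_integrand \<beta> y (Complex v pi)) =
    2 * sin (pi * \<beta>) * (exp v * (kfun \<beta> (y * exp v powr \<beta>) * (1 - exp v) powr (\<beta> - 1)))"
proof -
  define Y where "Y = y * exp v powr \<beta>"
  have p: "1 - exp v > 0" using assms by simp
  have "upper_powr (\<beta> - 1) (of_real (1 - exp v)) = exp (of_real (\<beta> - 1) * Ln (of_real (1 - exp v)))"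
  proof (rule upper_powr_eq)
    show "complex_of_real (1 - exp v) \<noteq> 0" using p by (metis of_real_eq_0_iff less_irrefl)
    show "0 \<le> Im (complex_of_real (1 - exp v))" by (simp only: Im_complex_of_real order_refl)
  qed
  also have "\<dots> = of_real (exp ((\<beta> - 1) * ln (1 - exp v)))"
    using p by (simp only: Ln_of_real exp_of_real flip: of_real_mult)
  also have "exp ((\<beta> - 1) * ln (1 - exp v)) = (1 - exp v) powr (\<beta> - 1)"
    using p by (simp add: powr_def)
  finally have u: "upper_powr (\<beta> - 1) (of_real (1 - exp v)) = of_real ((1 - exp v) powr (\<beta> - 1))" .
  have "rot_integrand \<beta> y (Complex v pi) = of_real (- (exp v / (kden \<beta> Y)\<^sup>2 * (1 - exp v) powr (\<beta> - 1))) *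
     (Complex (1 + cos (pi * \<beta>) * Y) (- sin (pi * \<beta>) * Y))\<^sup>2"
    using assms unfolding Y_def by (subst rot_integrand_boundary_eq) (auto simp only: u of_real_mult of_real_minus mult_minus_left)
  then have "Im (rot_integrand \<beta> y (Complex v pi)) = - (exp v / (kden \<beta> Y)\<^sup>2 * (1 - exp v) powr (\<beta> - 1)) *
     (2 * (1 + cos (pi * \<beta>) * Y) * (- sin (pi * \<beta>) * Y))"
    by (simp only: scaleR_conv_of_real[symmetric] scaleR_complex.sel Im_power2 complex.sel)
  also have "\<dots> = 2 * sin (pi * \<beta>) * (exp v * (kfun \<beta> Y * (1 - exp v) powr (\<beta> - 1)))"
    by (simp add: kfun_def)
  finally show ?thesis unfolding Y_def .
qed

text \<open>Here 1 - e^v is negative and its power contributes the additional phase e^(i pi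
  (\<beta>-1)) = -e^(i pi \<beta>). This removes the factor whose sign is uncertain for \<beta> >
  1/2.\<close>

lemma rot_integrand_Im_pos:
  assumes "0 < \<beta>" "\<beta> < 1" "y \<ge> 1" "v > 0"
  shows "Im (rot_integrand \<beta> y (Complex v pi)) \<le> 0"
proof -
  define Y where "Y = y * exp v powr \<beta>"
  have p: "exp v - 1 > 0" using assms by simp
  have c: "complex_of_real (1 - exp v) = - of_real (exp v - 1)" by simp
  have "upper_powr (\<beta> - 1) (of_real (1 - exp v)) = exp (of_real (\<beta> - 1) * Ln (of_real (1 - exp v)))"
  proof (rule upper_powr_eq)
    show "complex_of_real (1 - exp v) \<noteq> 0" using p
      by (metis of_real_eq_0_iff less_irrefl minus_diff_eq neg_0_equal_iff_equal)
    show "0 \<le> Im (complex_of_real (1 - exp v))" by (simp only: Im_complex_of_real order_refl)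
  qed
  also have "Ln (of_real (1 - exp v)) = of_real (ln (exp v - 1)) + \<i> * of_real pi"
  proof -
    have "Ln (- of_real (exp v - 1)) = Ln (of_real (exp v - 1)) + \<i> * of_real pi"
      using p by (subst Ln_minus) (auto simp only: Im_complex_of_real Re_complex_of_real of_real_eq_0_iff, auto)
    then show ?thesis using p unfolding c by (simp only: Ln_of_real)
  qed
  also have "of_real (\<beta> - 1) * (of_real (ln (exp v - 1)) + \<i> * of_real pi) =
      Complex ((\<beta> - 1) * ln (exp v - 1)) (pi * \<beta> - pi)"
    by (simp add: complex_eq_iff algebra_simps)
  also have "exp \<dots> = - of_real ((exp v - 1) powr (\<beta> - 1)) * Complex (cos (pi * \<beta>)) (sin (pi * \<beta>))"
    using p by (simp add: complex_eq_iff Re_exp Im_exp powr_def cos_diff sin_diff)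
  finally have u: "upper_powr (\<beta> - 1) (of_real (1 - exp v)) =
     - of_real ((exp v - 1) powr (\<beta> - 1)) * Complex (cos (pi * \<beta>)) (sin (pi * \<beta>))" .
  let ?E = "exp v / (kden \<beta> Y)\<^sup>2 * (exp v - 1) powr (\<beta> - 1)"
  have "rot_integrand \<beta> y (Complex v pi) = of_real ?E * (Complex (cos (pi * \<beta>)) (sin (pi * \<beta>)) *
     (Complex (1 + cos (pi * \<beta>) * Y) (- sin (pi * \<beta>) * Y))\<^sup>2)"
    using assms unfolding Y_def by (subst rot_integrand_boundary_eq) (auto simp only: u of_real_mult, simp_all)
  then have "Im (rot_integrand \<beta> y (Complex v pi)) = ?E * Im (Complex (cos (pi * \<beta>)) (sin (pi * \<beta>)) *
     (Complex (1 + cos (pi * \<beta>) * Y) (- sin (pi * \<beta>) * Y))\<^sup>2)"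
    by (simp only: scaleR_conv_of_real[symmetric] scaleR_complex.sel)
  \<comment> \<open>Expanding, e^(i pi \<beta>) (1 + Y e^(-i pi \<beta>))^2 = e^(i pi \<beta>) + 2 Y
    + Y^2 e^(-i pi \<beta>); the cross term is real.\<close>
  also have "Im (Complex (cos (pi * \<beta>)) (sin (pi * \<beta>)) *
     (Complex (1 + cos (pi * \<beta>) * Y) (- sin (pi * \<beta>) * Y))\<^sup>2) = sin (pi * \<beta>) * (1 - Y\<^sup>2)"
  proof -
    have "(sin (pi * \<beta>))\<^sup>2 + (cos (pi * \<beta>))\<^sup>2 = 1" by simp
    then show ?thesis
      unfolding times_complex.sel complex.sel Re_power2 Im_power2 by algebra
  qed
  also have "?E * (sin (pi * \<beta>) * (1 - Y\<^sup>2)) \<le> 0"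
  proof -
    have "1 * 1 \<le> y * exp v powr \<beta>"
      using assms by (intro mult_mono) (auto intro!: ge_one_powr_ge_zero)
    then have "Y\<^sup>2 \<ge> 1" unfolding Y_def by (simp add: one_le_power)
    moreover have "sin (pi * \<beta>) \<ge> 0" using assms by (intro sin_ge_zero) (auto simp: mult_left_le)
    moreover have "?E \<ge> 0" by simp
    ultimately show ?thesis by (intro mult_nonneg_nonpos) auto
  qed
  finally show ?thesis .
qed

text \<open>The imaginary part integrates to 0 along the edge and is nonpositive for v > 0; so the
  part over v < 0, a positive multiple of the integral in question, is nonnegative. The condition t
  \<ge> 1 gives y \<ge> 1, hence Y \<ge> 1 for all v > 0.\<close>

lemma phi_integral_nonneg_large:
  assumes "0 < \<beta>" "\<beta> < 1" "t \<ge> 1"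
  shows "(LINT r:{0<..<1}|lborel. kfun \<beta> ((t * r) powr \<beta>) * (1 - r) powr (\<beta> - 1)) \<ge> 0"
proof -
  define y where "y = t powr \<beta>"
  have y: "y \<ge> 1" using assms by (simp add: y_def ge_one_powr_ge_zero)
  \<comment> \<open>The cut-off at r = 1 makes \<open>f (exp v)\<close> vanish for v > 0, so one
    pointwise inequality on the whole line covers both half-lines.\<close>
  define f where "f = (\<lambda>r. indicat_real {0<..<1} r * (kfun \<beta> ((t * r) powr \<beta>) * (1 - r) powr (\<beta> - 1)))"
  have [measurable]: "f \<in> borel_measurable borel" unfolding f_def by measurable
  have s: "sin (pi * \<beta>) > 0" using assms by (intro sin_gt_zero) (auto simp: mult_less_cancel_left1)
  have "integrable lborel f"
    using phi_integrand_integrable[of \<beta> t] assms by (simp add: f_def set_integrable_def)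
  then have "set_integrable lborel {0<..} f"
    unfolding set_integrable_def by (rule integrable_mult_indicator[rotated]) auto
  then have int: "integrable lborel (\<lambda>v. exp v * f (exp v))" by (subst exp_substitution(1)) auto
  have "0 = (LINT v|lborel. Im (rot_integrand \<beta> y (Complex v pi)))"
    using rot_integrand_boundary(2)[of \<beta> y] assms y by simp
  also have "\<dots> \<le> (LINT v|lborel. 2 * sin (pi * \<beta>) * (exp v * f (exp v)))"
  proof (rule integral_mono_AE)
    show "integrable lborel (\<lambda>v. Im (rot_integrand \<beta> y (Complex v pi)))"
      using rot_integrand_boundary(1)[of \<beta> y] assms y by simp
    show "integrable lborel (\<lambda>v. 2 * sin (pi * \<beta>) * (exp v * f (exp v)))"
      using int by simp
    show "AE v in lborel. Im (rot_integrand \<beta> y (Complex v pi)) \<le> 2 * sin (pi * \<beta>) * (exp v * f (exp v))"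
      using AE_lborel_singleton[of "0::real"]
    proof eventually_elim
      fix v :: real assume "v \<noteq> 0"
      then consider "v < 0" | "v > 0" by linarith
      then show "Im (rot_integrand \<beta> y (Complex v pi)) \<le> 2 * sin (pi * \<beta>) * (exp v * f (exp v))"
      proof cases
        case 1
        have "(t * exp v) powr \<beta> = y * exp v powr \<beta>" using assms by (simp add: y_def powr_mult)
        then show ?thesis using 1 assms y by (simp add: rot_integrand_Im_neg f_def)
      next
        case 2
        then have "f (exp v) = 0" by (simp add: f_def)
        then show ?thesis using 2 rot_integrand_Im_pos[of \<beta> y v] assms y by simp
      qed
    qed
  qed
  also have "\<dots> = 2 * sin (pi * \<beta>) * (LINT x:{0<..}|lborel. f x)"
    by (simp add: exp_substitution(2))
  also have "(LINT x:{0<..}|lborel. f x) =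
     (LINT r:{0<..<1}|lborel. kfun \<beta> ((t * r) powr \<beta>) * (1 - r) powr (\<beta> - 1))"
    unfolding set_lebesgue_integral_def f_def
    by (intro Bochner_Integration.integral_cong) (auto simp: indicator_def)
  finally show ?thesis using s by (simp add: zero_le_mult_iff)
qed

lemma phi_beta_nonneg:
  assumes "0 < \<beta>" "\<beta> < 1" "t > 0"
  shows "phi_beta \<beta> t \<ge> 0"
proof -
  have s: "sin (pi * \<beta>) \<ge> 0" using assms by (intro sin_ge_zero) (auto simp: mult_left_le)
  have "(LINT r:{0<..<1}|lborel. kfun \<beta> ((t * r) powr \<beta>) * (1 - r) powr (\<beta> - 1)) \<ge> 0"
  proof (cases "t \<ge> 1")
    case True
    then show ?thesis using phi_integral_nonneg_large assms by blast
  next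
    case False
    have "kfun \<beta> ((t * r) powr \<beta>) \<ge> 0" if "0 < r" "r < 1" for r
    proof -
      have "t * r \<le> 1 * 1" using False that assms by (intro mult_mono) auto
      then have 1: "(t * r) powr \<beta> \<le> 1" using that assms by (intro powr_le1) auto
      have "-1 * (t * r) powr \<beta> \<le> cos (pi * \<beta>) * (t * r) powr \<beta>"
        by (intro mult_right_mono) auto
      then have "1 + cos (pi * \<beta>) * (t * r) powr \<beta> \<ge> 0" using 1 by simp
      then show ?thesis by (simp add: kfun_def)
    qed
    then show ?thesis unfolding set_lebesgue_integral_def
      by (intro integral_nonneg_AE AE_I2) (auto simp: indicator_def)
  qed
  then show ?thesis unfolding phi_beta_alt[OF assms(3)] using s assms by simp
qed

section \<open>The order-one representation\<close>

text \<open>Comparison with the standard kernel: the quotient is u^(1-\<beta>) (1 + u^\<beta>)/(u +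
  s), and u^(1-\<beta>) \<le> u + 1 bounds its numerator by 2 u + 1.\<close>

lemma geometric_kernel_integrable:
  fixes \<beta> s :: real
  assumes "0 < \<beta>" "\<beta> < 1" "s > 0"
  shows "set_integrable lborel {0<..} (\<lambda>u. 1 / ((u + s) * (1 + u powr \<beta>)))"
proof (rule set_integrable_bound)
  show "set_integrable lborel {0<..} (\<lambda>u. (2 + 1 / s) * (u powr (\<beta> - 1) / (1 + u powr \<beta>)\<^sup>2))"
    by (intro set_integrable_mult_right powr_kernel_integrable assms)
  show "AE u in lborel. u \<in> {0<..} \<longrightarrow> norm (1 / ((u + s) * (1 + u powr \<beta>)))
    \<le> norm ((2 + 1 / s) * (u powr (\<beta> - 1) / (1 + u powr \<beta>)\<^sup>2))"
  proof (intro AE_I2 impI)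
    fix u :: real assume "u \<in> {0<..}"
    then have u: "u > 0" by simp
    have p: "1 + u powr \<beta> > 0" by (simp add: add_pos_nonneg)
    have "u powr (1 - \<beta>) \<le> u + 1"
    proof (cases "u \<le> 1")
      case True
      then have "u powr (1 - \<beta>) \<le> 1" using u assms by (intro powr_le1) auto
      then show ?thesis using u by simp
    next
      case False
      then have "u powr (1 - \<beta>) \<le> u powr 1" using u assms by (intro powr_mono) auto
      then show ?thesis using u by simp
    qed
    moreover have "u powr (1 - \<beta>) * u powr \<beta> = u" using u by (simp flip: powr_add)
    ultimately have "u powr (1 - \<beta>) * (1 + u powr \<beta>) \<le> 2 * u + 1" by (simp add: algebra_simps)
    also have "\<dots> \<le> (2 + 1 / s) * (u + s)" using u assms by (simp add: field_simps)
    finally have *: "u powr (1 - \<beta>) * (1 + u powr \<beta>) \<le> (2 + 1 / s) * (u + s)" .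
    have k: "u powr (\<beta> - 1) * (u powr (1 - \<beta>) * (1 + u powr \<beta>)) = 1 + u powr \<beta>"
      using u by (simp flip: powr_add mult.assoc)
    have "norm (1 / ((u + s) * (1 + u powr \<beta>))) = 1 / ((u + s) * (1 + u powr \<beta>))"
      using u assms p by (simp add: abs_mult)
    also have "\<dots> = u powr (\<beta> - 1) * (u powr (1 - \<beta>) * (1 + u powr \<beta>)) / ((u + s) * (1 + u powr \<beta>)\<^sup>2)"
      unfolding k using p by (simp add: power2_eq_square)
    also have "\<dots> \<le> u powr (\<beta> - 1) * ((2 + 1 / s) * (u + s)) / ((u + s) * (1 + u powr \<beta>)\<^sup>2)"
      using * u assms by (intro divide_right_mono mult_left_mono) auto
    also have "\<dots> = (2 + 1 / s) * (u powr (\<beta> - 1) / (1 + u powr \<beta>)\<^sup>2)"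
      using u assms p by (simp only: times_divide_eq_right mult.assoc[symmetric]) (simp add: mult.commute)
    also have "\<dots> \<le> norm \<dots>" by (simp only: real_norm_def abs_ge_self)
    finally show "norm (1 / ((u + s) * (1 + u powr \<beta>))) \<le> norm ((2 + 1 / s) * (u powr (\<beta> - 1) / (1 + u powr \<beta>)\<^sup>2))" .
  qed
qed (auto simp: set_borel_measurable_def)

text \<open>The Cauchy integrand dz / ((1 + z^\<beta>)(z - s)) in the coordinate z = exp w.\<close>

definition pole_integrand :: "real \<Rightarrow> real \<Rightarrow> complex \<Rightarrow> complex" where
  "pole_integrand \<beta> s w = exp w / (1 + exp (of_real \<beta> * w)) / (exp w - of_real s)"

text \<open>The parameter \<open>d\<close> leaves the distance to the pole open: on the lines Im w =
  pi and Im w = -pi it is exp (Re w) + s, on the vertical sides |exp (Re w) - s|.\<close>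

lemma pole_integrand_bound:
  assumes "0 < \<beta>" "\<beta> < 1" "\<bar>Im w\<bar> \<le> pi" "d > 0" "norm (exp w - of_real s) \<ge> d"
  shows "norm (pole_integrand \<beta> s w) \<le> exp (Re w) / (sqrt (kconst \<beta>) * (1 + exp (Re w) powr \<beta>) * d)"
proof -
  have e: "exp (\<beta> * Re w) = exp (Re w) powr \<beta>" by (simp add: exp_powr_real mult.commute)
  have l: "kconst \<beta> > 0" using kconst_pos assms by auto
  have p: "1 + exp (Re w) powr \<beta> > 0" by (simp add: add_pos_nonneg)
  have "(sqrt (kconst \<beta>) * (1 + exp (Re w) powr \<beta>))\<^sup>2 \<le> (norm (1 + exp (of_real \<beta> * w)))\<^sup>2"
    using one_plus_exp_norm[of \<beta> 1 w] assms l by (simp add: power_mult_distrib e)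
  then have q: "sqrt (kconst \<beta>) * (1 + exp (Re w) powr \<beta>) \<le> norm (1 + exp (of_real \<beta> * w))"
    by (rule power2_le_imp_le) simp
  have q0: "sqrt (kconst \<beta>) * (1 + exp (Re w) powr \<beta>) > 0"
    using l p by (intro mult_pos_pos) auto
  have "norm (pole_integrand \<beta> s w) = exp (Re w) / (norm (1 + exp (of_real \<beta> * w)) * norm (exp w - of_real s))"
    by (simp add: pole_integrand_def norm_divide norm_mult)
  also have "\<dots> \<le> exp (Re w) / (sqrt (kconst \<beta>) * (1 + exp (Re w) powr \<beta>) * d)"
    by (intro divide_left_mono mult_mono mult_pos_pos order_less_le_trans[OF q0 q]
        order_less_le_trans[OF assms(4,5)] real_sqrt_gt_zero l p q assms(4,5)) (use assms(4) in simp_all)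
  finally show ?thesis .
qed

lemma pole_integrand_dominator_tendsto:
  assumes "0 < \<beta>" "\<beta> < 1" "s > 0"
  defines "B \<equiv> \<lambda>v. exp v / (sqrt (kconst \<beta>) * (1 + exp v powr \<beta>) * \<bar>exp v - s\<bar>)"
  shows "(B \<longlongrightarrow> 0) at_top" "(B \<longlongrightarrow> 0) at_bot"
proof -
  define g where "g = (\<lambda>x. x / (sqrt (kconst \<beta>) * (1 + x powr \<beta>) * \<bar>x - s\<bar>))"
  have B: "B = (\<lambda>v. g (exp v))" by (simp add: B_def g_def)
  have l: "sqrt (kconst \<beta>) > 0" using kconst_pos assms by auto
  have "(g \<longlongrightarrow> 0 / (sqrt (kconst \<beta>) * (1 + 0) * \<bar>0 - s\<bar>)) (at_right 0)"
    unfolding g_def using l assms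
    by (intro tendsto_intros) (auto intro!: tendsto_eq_intros simp: eventually_at_right_less eventually_at_filter)
  then have "(g \<longlongrightarrow> 0) (at_right 0)" by simp
  moreover have "filterlim (exp :: real \<Rightarrow> real) (at_right 0) at_bot" by real_asymp
  ultimately show "(B \<longlongrightarrow> 0) at_bot" unfolding B by (rule filterlim_compose)
  have "(g \<longlongrightarrow> 0) at_top"
  proof (rule Lim_null_comparison)
    show "\<forall>\<^sub>F x in at_top. norm (g x) \<le> (2 / sqrt (kconst \<beta>)) * x powr (-\<beta>)"
      using eventually_ge_at_top[of "2 * s"]
    proof eventually_elim
      fix x :: real assume x: "x \<ge> 2 * s"
      then have x0: "x > 0" using assms by simp
      have "norm (g x) = x / (sqrt (kconst \<beta>) * (1 + x powr \<beta>) * \<bar>x - s\<bar>)"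
        unfolding g_def using x0 l by (simp add: abs_mult)
      also have "\<dots> \<le> x / (sqrt (kconst \<beta>) * x powr \<beta> * (x / 2))"
        using x x0 l assms by (intro divide_left_mono mult_mono mult_pos_pos) (auto simp: add_pos_nonneg)
      also have "\<dots> = (2 / sqrt (kconst \<beta>)) * x powr (-\<beta>)"
        using x0 by (simp add: powr_minus_divide)
      finally show "norm (g x) \<le> (2 / sqrt (kconst \<beta>)) * x powr (-\<beta>)" .
    qed
    have "((\<lambda>x::real. x powr (-\<beta>)) \<longlongrightarrow> 0) at_top"
      using assms by (intro tendsto_neg_powr filterlim_ident) auto
    then show "((\<lambda>x. (2 / sqrt (kconst \<beta>)) * x powr (-\<beta>)) \<longlongrightarrow> 0) at_top"
      by (rule tendsto_mult_right_zero)
  qed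
  then show "(B \<longlongrightarrow> 0) at_top" unfolding B using exp_at_top by (rule filterlim_compose)
qed

lemma pole_integrand_contour:
  assumes "0 < \<beta>" "\<beta> < 1" "s > 0" "R > \<bar>ln s\<bar>"
  shows "contour_integral (rectpath (Complex (-R) (-pi)) (Complex R pi)) (pole_integrand \<beta> s) = 2 * pi * \<i> / of_real (1 + s powr \<beta>)"
proof -
  \<comment> \<open>Room beyond the rectangle: pi/\<beta> is the height of the first zeros of 1 +
    exp(\<beta> w), and 2 pi that of the next copies of the pole ln s. Both exceed pi.\<close>
  define h where "h = min (pi / \<beta>) (2 * pi)"
  have h: "h > pi" "h * \<beta> \<le> pi" "h \<le> 2 * pi"
    using assms by (auto simp: h_def min_def field_simps)
  define S where "S = {w. - h < Im w} \<inter> {w. Im w < h}"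
  let ?p = "of_real (ln s) :: complex"
  have S: "open S" "convex S"
    unfolding S_def by (intro open_Int open_halfspace_Im_gt open_halfspace_Im_lt
        convex_Int convex_halfspace_Im_gt convex_halfspace_Im_lt)+
  have nz1: "1 + exp (of_real \<beta> * w) \<noteq> 0" if "w \<in> S" for w
  proof
    assume *: "1 + exp (of_real \<beta> * w) = 0"
    have "\<bar>\<beta> * Im w\<bar> < \<beta> * h" using that assms by (auto simp: S_def abs_mult)
    then have b: "\<bar>\<beta> * Im w\<bar> < pi" using h by (simp add: mult.commute)
    have "Im (1 + exp (of_real \<beta> * w)) = 0" using * by simp
    then have "sin (\<beta> * Im w) = 0" by (simp add: Im_exp)
    then have "\<beta> * Im w = 0" using b sin_eq_0_pi[of "\<beta> * Im w"] by linarith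
    then have "cos (\<beta> * Im w) = 1" by (simp only: cos_zero)
    then have "Re (1 + exp (of_real \<beta> * w)) = 1 + exp (\<beta> * Re w)" by (simp add: Re_exp)
    moreover have "1 + exp (\<beta> * Re w) > 0" by (simp add: add_pos_pos)
    ultimately show False unfolding * by simp
  qed
  have nz2: "exp w - of_real s \<noteq> 0" if "w \<in> S" "w \<noteq> ?p" for w
  proof
    assume "exp w - of_real s = 0"
    then have "exp w = exp ?p" using assms by (simp add: exp_of_real)
    then obtain n :: int where n: "w = ?p + of_int (2 * n) * pi * \<i>" by (auto simp: exp_eq)
    then have "Im w = 2 * of_int n * pi" by simp
    moreover have "\<bar>Im w\<bar> < 2 * pi" using that h by (auto simp: S_def)
    ultimately have "\<bar>real_of_int n\<bar> * (2 * pi) < 1 * (2 * pi)" by (simp add: abs_mult)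
    then have "\<bar>real_of_int n\<bar> < 1" by (rule mult_right_less_imp_less) simp
    then have "n = 0" by linarith
    then show False using n that by simp
  qed
  have p: "?p \<in> S" using h pi_gt_zero by (simp add: S_def)
  have holo: "pole_integrand \<beta> s holomorphic_on S - {?p}"
    unfolding pole_integrand_def using nz1 nz2 by (intro holomorphic_intros) auto
  have inbox: "?p \<in> box (Complex (-R) (-pi)) (Complex R pi)"
    using assms by (auto simp: in_box_complex_iff)
  have sub: "cbox (Complex (-R) (-pi)) (Complex R pi) \<subseteq> S"
    using h by (auto simp: in_cbox_complex_iff S_def)
  have R: "R \<ge> 0" using assms by linarith
  have "contour_integral (rectpath (Complex (-R) (-pi)) (Complex R pi)) (pole_integrand \<beta> s) =
     2 * pi * \<i> * (\<Sum>q\<in>{?p}. winding_number (rectpath (Complex (-R) (-pi)) (Complex R pi)) q * residue (pole_integrand \<beta> s) q)"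
  proof (rule Residue_theorem[OF S(1) convex_connected[OF S(2)] _ holo])
    show "path_image (rectpath (Complex (- R) (- pi)) (Complex R pi)) \<subseteq> S - {?p}"
      using path_image_rectpath_subset_cbox[of "Complex (- R) (- pi)" "Complex R pi"]
        path_image_rectpath_inter_box[of "Complex (- R) (- pi)" "Complex R pi"] sub R inbox
      by auto
    show "\<forall>z. z \<notin> S \<longrightarrow> winding_number (rectpath (Complex (- R) (- pi)) (Complex R pi)) z = 0"
      using sub R by (auto intro!: winding_number_rectpath_outside)
  qed auto
  moreover have "residue (pole_integrand \<beta> s) ?p = (exp ?p / (1 + exp (of_real \<beta> * ?p))) / exp ?p"
    unfolding pole_integrand_def
  proof (rule residue_simple_pole_deriv)
    show "(\<lambda>w. exp w / (1 + exp (complex_of_real \<beta> * w))) holomorphic_on S"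
      using nz1 by (intro holomorphic_intros) auto
    show "(\<lambda>w. exp w - of_real s) holomorphic_on S" by (intro holomorphic_intros)
    show "((\<lambda>w. exp w - of_real s) has_field_derivative exp ?p) (at ?p)"
      by (auto intro!: derivative_eq_intros)
    show "exp ?p / (1 + exp (complex_of_real \<beta> * ?p)) \<noteq> 0" using nz1[OF p] by simp
    show "exp ?p - of_real s = 0" using assms by (simp add: exp_of_real)
  qed (use S p convex_connected in auto)
  moreover have "exp (of_real \<beta> * ?p) = of_real (s powr \<beta>)"
    using assms by (simp only: powr_def exp_of_real flip: of_real_mult) simp
  ultimately show ?thesis using winding_number_rectpath[OF inbox] by simp
qed

text \<open>Both lines Im w = pi and Im w = -pi lie over the negative axis, one on each side of the
  cut. The difference of the two line integrals is the integral of the jump, and it equals the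
  residue contribution at z = s.\<close>

lemma stieltjes_kernel_order_one:
  assumes "0 < \<beta>" "\<beta> < 1" "s > 0"
  defines "f \<equiv> \<lambda>u. sin (pi * \<beta>) / pi * (u powr \<beta> / kden \<beta> (u powr \<beta>)) / (u + s)"
  shows "set_integrable lborel {0<..} f" "(LINT u:{0<..}|lborel. f u) = 1 / (1 + s powr \<beta>)"
proof -
  have l: "sqrt (kconst \<beta>) > 0" using kconst_pos assms by auto
  have [measurable]: "f \<in> borel_measurable borel" unfolding f_def by measurable
  have dnz: "1 + exp (of_real \<beta> * w) \<noteq> 0" if "\<bar>Im w\<bar> \<le> pi" for w
    using one_plus_exp_nonzero[of \<beta> 1 w] assms that by simp
  have es: "norm (exp w - of_real s) = exp (Re w) + s" if "\<bar>Im w\<bar> = pi" for w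
  proof -
    have "exp w - of_real s = - of_real (exp (Re w) + s)"
    proof -
      have "Im w = pi \<or> Im w = - pi" using that by linarith
      then show ?thesis by (auto simp: complex_eq_iff Re_exp Im_exp)
    qed
    then show ?thesis using assms by (simp only: norm_minus_cancel norm_of_real) (simp add: add_pos_pos)
  qed
  have ge: "norm (exp w - of_real s) \<ge> \<bar>exp (Re w) - s\<bar>" for w
    using norm_triangle_ineq3[of "exp w" "of_real s"] assms by (simp add: norm_exp_eq_Re)
  have ctn: "isCont (pole_integrand \<beta> s) w" if "\<bar>Im w\<bar> \<le> pi" "exp w \<noteq> of_real s" for w
    unfolding pole_integrand_def using that dnz by (intro continuous_intros) auto
  have line: "integrable lborel (\<lambda>x. pole_integrand \<beta> s (Complex x h))" if h: "\<bar>h\<bar> = pi" for h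
  proof (rule Bochner_Integration.integrable_bound)
    have "set_integrable lborel {0<..} (\<lambda>u. 1 / sqrt (kconst \<beta>) * (1 / ((u + s) * (1 + u powr \<beta>))))"
      by (intro set_integrable_mult_right geometric_kernel_integrable assms)
    then show "integrable lborel (\<lambda>x. exp x * (1 / sqrt (kconst \<beta>) * (1 / ((exp x + s) * (1 + exp x powr \<beta>)))))"
      by (subst exp_substitution(1)) auto
    have "continuous_on UNIV (\<lambda>x. pole_integrand \<beta> s (Complex x h))"
    proof (intro continuous_at_imp_continuous_on ballI)
      fix x :: real
      have "exp x + s > 0" using assms by (simp add: add_pos_pos)
      then have "isCont (pole_integrand \<beta> s) (Complex x h)"
        using h es[of "Complex x h"] by (intro ctn) auto
      moreover have "isCont (\<lambda>x. of_real x + \<i> * of_real h) x" by (intro continuous_intros)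
      then have "isCont (\<lambda>x. Complex x h) x" by (simp add: Complex_eq)
      ultimately show "isCont (\<lambda>x. pole_integrand \<beta> s (Complex x h)) x" by (rule isCont_o2[rotated])
    qed
    then show "(\<lambda>x. pole_integrand \<beta> s (Complex x h)) \<in> borel_measurable lborel"
      by (simp add: borel_measurable_continuous_onI)
    show "AE x in lborel. norm (pole_integrand \<beta> s (Complex x h)) \<le>
      norm (exp x * (1 / sqrt (kconst \<beta>) * (1 / ((exp x + s) * (1 + exp x powr \<beta>)))))"
    proof (rule AE_I2)
      fix x :: real
      have p: "exp x + s > 0" using assms by (simp add: add_pos_pos)
      have "norm (pole_integrand \<beta> s (Complex x h)) \<le> exp x / (sqrt (kconst \<beta>) * (1 + exp x powr \<beta>) * (exp x + s))"
        using pole_integrand_bound[of \<beta> "Complex x h" "exp x + s" s] es[of "Complex x h"] h p assms by simp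
      also have "\<dots> = exp x * (1 / sqrt (kconst \<beta>) * (1 / ((exp x + s) * (1 + exp x powr \<beta>))))"
        by (simp add: mult_ac)
      finally show "norm (pole_integrand \<beta> s (Complex x h)) \<le>
        norm (exp x * (1 / sqrt (kconst \<beta>) * (1 / ((exp x + s) * (1 + exp x powr \<beta>)))))"
        unfolding real_norm_def by (rule order_trans[OF _ abs_ge_self])
    qed
  qed
  have "(LINT x|lborel. pole_integrand \<beta> s (Complex x (-pi))) - (LINT x|lborel. pole_integrand \<beta> s (Complex x pi)) = 2 * pi * \<i> / of_real (1 + s powr \<beta>)"
  \<comment> \<open>Beyond this \<open>\<rho>\<close> the modulus exp (Re z) differs from s, so the
    vertical sides miss the pole.\<close>
  proof (rule strip_contour[where \<rho> = "\<bar>ln s\<bar> + 1", OF _ _ _ _ _ pole_integrand_dominator_tendsto[OF assms(1-3)]])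
    show "- pi < pi" by simp
    have ne: "exp (Re z) \<noteq> s" if "\<bar>ln s\<bar> + 1 \<le> \<bar>Re z\<bar>" for z
    proof
      assume "exp (Re z) = s"
      then have "ln s = Re z" by auto
      then show False using that by simp
    qed
    show "continuous_on {z. Im z = - pi \<or> Im z = pi \<or> - pi \<le> Im z \<and> Im z \<le> pi \<and> \<bar>ln s\<bar> + 1 \<le> \<bar>Re z\<bar>} (pole_integrand \<beta> s)"
    proof (intro continuous_at_imp_continuous_on ballI ctn)
      fix z assume z: "z \<in> {z. Im z = - pi \<or> Im z = pi \<or> - pi \<le> Im z \<and> Im z \<le> pi \<and> \<bar>ln s\<bar> + 1 \<le> \<bar>Re z\<bar>}"
      then show "\<bar>Im z\<bar> \<le> pi" by auto
      show "exp z \<noteq> of_real s"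
      proof (cases "\<bar>Im z\<bar> = pi")
        case True
        have "exp (Re z) + s > 0" using assms by (simp add: add_pos_pos)
        then show ?thesis using es[OF True] by auto
      next
        case False
        then show ?thesis using z ge[of z] ne[of z] by auto
      qed
    qed
    show "\<forall>\<^sub>F R in at_top. contour_integral (rectpath (Complex (- R) (- pi)) (Complex R pi)) (pole_integrand \<beta> s) =
       2 * pi * \<i> / of_real (1 + s powr \<beta>)"
      using eventually_gt_at_top[of "\<bar>ln s\<bar>"] by eventually_elim (intro pole_integrand_contour assms)
    fix z :: complex assume z: "- pi \<le> Im z" "Im z \<le> pi" "\<bar>ln s\<bar> + 1 \<le> \<bar>Re z\<bar>"
    show "norm (pole_integrand \<beta> s z) \<le> exp (Re z) / (sqrt (kconst \<beta>) * (1 + exp (Re z) powr \<beta>) * \<bar>exp (Re z) - s\<bar>)"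
      using z assms ge[of z] ne[of z] by (intro pole_integrand_bound) auto
  qed (auto intro!: line)
  then have "(LINT x|lborel. pole_integrand \<beta> s (Complex x (-pi)) - pole_integrand \<beta> s (Complex x pi)) = 2 * pi * \<i> / of_real (1 + s powr \<beta>)"
    by (subst Bochner_Integration.integral_diff) (auto intro!: line)
  \<comment> \<open>The factors exp w and exp w - s agree on the two lines, so only the jump 1/p -
    1/q of 1/(1 + z^\<beta>) remains, where p and q are conjugate with product
    \<open>kden \<beta> Y\<close>.\<close>
  moreover have diff: "pole_integrand \<beta> s (Complex x (-pi)) - pole_integrand \<beta> s (Complex x pi) = of_real (exp x * f (exp x)) * (2 * pi * \<i>)" for x
  proof -
    define Y where "Y = exp x powr \<beta>"
    have Y: "Y = exp (\<beta> * x)" by (simp add: Y_def exp_powr_real mult.commute)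
    let ?q = "Complex (1 + cos (pi * \<beta>) * Y) (sin (pi * \<beta>) * Y)"
    let ?p = "Complex (1 + cos (pi * \<beta>) * Y) (- sin (pi * \<beta>) * Y)"
    have d: "kden \<beta> Y > 0" using kden_pos assms by (simp add: Y_def)
    have e: "exp (Complex x pi) = - of_real (exp x)" "exp (Complex x (-pi)) = - of_real (exp x)"
      by (simp_all add: complex_eq_iff Re_exp Im_exp)
    have q: "1 + exp (of_real \<beta> * Complex x pi) = ?q" "1 + exp (of_real \<beta> * Complex x (-pi)) = ?p"
      by (simp_all add: complex_eq_iff Re_exp Im_exp Y mult_ac)
    have "(sin (pi * \<beta>))\<^sup>2 + (cos (pi * \<beta>))\<^sup>2 = 1" by simp
    then have "(1 + cos (pi * \<beta>) * Y) * (1 + cos (pi * \<beta>) * Y) + (sin (pi * \<beta>) * Y) * (sin (pi * \<beta>) * Y)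
        = Y\<^sup>2 + 2 * cos (pi * \<beta>) * Y + 1" by algebra
    then have qp: "?q * ?p = of_real (kden \<beta> Y)"
      by (simp add: complex_eq_iff kden_def)
    then have nz: "?q \<noteq> 0" "?p \<noteq> 0" using d by auto
    have "?q - ?p = of_real (sin (pi * \<beta>) * Y) * (2 * \<i>)" by (simp add: complex_eq_iff)
    then have pq: "1 / ?p - 1 / ?q = of_real (sin (pi * \<beta>) * Y) * (2 * \<i>) / of_real (kden \<beta> Y)"
      using nz by (subst qp[symmetric]) (simp add: field_simps)
    have z: "- of_real (exp x) - of_real s = - complex_of_real (exp x + s)" by simp
    have "pole_integrand \<beta> s (Complex x (-pi)) - pole_integrand \<beta> s (Complex x pi) = of_real (exp x) / complex_of_real (exp x + s) * (1 / ?p - 1 / ?q)"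
    proof -
      have "- E / P / (- T) - (- E / Q / (- T)) = E / T * (1 / P - 1 / Q)" for E T P Q :: complex
        by (simp add: right_diff_distrib mult.commute)
      then show ?thesis unfolding pole_integrand_def e q z .
    qed
    also have "\<dots> = of_real (exp x * f (exp x)) * (2 * pi * \<i>)"
      unfolding pq f_def Y_def[symmetric] by (simp add: mult_ac)
    finally show ?thesis .
  qed
  \<comment> \<open>Integrability of the real density is read off from the contour integrands by
    taking imaginary parts in \<open>diff\<close>.\<close>
  moreover have int: "integrable lborel (\<lambda>x. exp x * f (exp x))"
  proof -
    have "integrable lborel (\<lambda>x. pole_integrand \<beta> s (Complex x (-pi)) - pole_integrand \<beta> s (Complex x pi))"
      by (auto intro!: line)
    then have "integrable lborel (\<lambda>x. Im (of_real (exp x * f (exp x)) * (2 * pi * \<i>)))"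
      unfolding diff by (rule integrable_Im)
    then show ?thesis by simp
  qed
  moreover have "(LINT x|lborel. of_real (exp x * f (exp x)) * (2 * pi * \<i>)) =
      complex_of_real (LINT x|lborel. exp x * f (exp x)) * (2 * pi * \<i>)"
    by (simp only: integral_mult_left_zero integral_complex_of_real)
  ultimately have "complex_of_real (LINT x|lborel. exp x * f (exp x)) * (2 * pi * \<i>) = of_real (1 / (1 + s powr \<beta>)) * (2 * pi * \<i>)"
    by (simp only:) simp
  then have "complex_of_real (LINT x|lborel. exp x * f (exp x)) = of_real (1 / (1 + s powr \<beta>))"
    by (subst (asm) mult_cancel_right) auto
  then have "(LINT x|lborel. exp x * f (exp x)) = 1 / (1 + s powr \<beta>)" by (simp only: of_real_eq_iff)
  then show "(LINT u:{0<..}|lborel. f u) = 1 / (1 + s powr \<beta>)" by (simp add: exp_substitution(2))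
  show "set_integrable lborel {0<..} f" using int by (simp add: exp_substitution(1))
qed

section \<open>From order one to order \<open>\<beta>\<close>\<close>

lemma integrable_product_lborel:
  fixes a b :: "real \<Rightarrow> real"
  assumes "integrable lborel a" "integrable lborel b"
  shows "integrable (lborel \<Otimes>\<^sub>M lborel) (\<lambda>(x, y). a x * b y)"
proof -
  have [measurable]: "a \<in> borel_measurable borel" "b \<in> borel_measurable borel"
    using assms by (auto dest: borel_measurable_integrable)
  show ?thesis
    by (rule lborel_pair.Fubini_integrable) (use assms in \<open>auto simp: abs_mult\<close>)
qed

lemma sin_pi_pos: "0 < \<beta> \<Longrightarrow> \<beta> < 1 \<Longrightarrow> sin (pi * \<beta>) > 0"
  by (intro sin_gt_zero) (auto simp: mult_less_cancel_left1)

text \<open>The Moebius map (1 - r)/(s r + x) has derivative -(x + s)/(s r + x)^2, so the integrand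
  is, up to a constant, the derivative of the \<beta>-th power of this map. It runs from 1/x down to
  0.\<close>

lemma abel_kernel_integral:
  fixes \<beta> s x :: real
  assumes "0 < \<beta>" "\<beta> < 1" "s > 0" "x > 0"
  defines "f \<equiv> \<lambda>r. (1 - r) powr (\<beta> - 1) * (s * r + x) powr (- \<beta> - 1)"
  shows "set_integrable lborel {0<..<1} f"
    and "(LINT r:{0<..<1}|lborel. f r) = x powr (- \<beta>) / (\<beta> * (x + s))"
proof -
  let ?F = "\<lambda>r. - (((1 - r) / (s * r + x)) powr \<beta> / (\<beta> * (x + s)))"
  have e: "einterval (ereal 0) (ereal 1) = {0<..<1}" by (auto simp: einterval_def)
  have D: "DERIV ?F r :> f r" if "0 < r" "r < 1" for r
  proof -
    have p: "s * r + x > 0" "1 - r > 0" using that assms by (auto intro: add_pos_pos)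
    have "DERIV (\<lambda>r. (1 - r) / (s * r + x)) r :> - (x + s) / (s * r + x)\<^sup>2"
      using p by (auto intro!: derivative_eq_intros simp: power2_eq_square field_simps)
    then have "DERIV ?F r :> - ((\<beta> * ((1 - r) / (s * r + x)) powr (\<beta> - 1) * (- (x + s) / (s * r + x)\<^sup>2)) / (\<beta> * (x + s)))"
      using p by (intro derivative_intros DERIV_cdivide DERIV_minus DERIV_fun_powr) auto
    also have "- ((\<beta> * ((1 - r) / (s * r + x)) powr (\<beta> - 1) * (- (x + s) / (s * r + x)\<^sup>2)) / (\<beta> * (x + s)))
       = ((1 - r) / (s * r + x)) powr (\<beta> - 1) / (s * r + x)\<^sup>2"
    proof -
      have gen: "- ((b * Z * (- X / T)) / (b * X)) = Z / T" if "b \<noteq> 0" "X \<noteq> 0" for b X Z T :: real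
        using that by (cases "T = 0") (simp_all add: divide_simps)
      show ?thesis by (rule gen) (use assms in auto)
    qed
    also have "\<dots> = (1 - r) powr (\<beta> - 1) / ((s * r + x) powr (\<beta> - 1) * (s * r + x) powr 2)"
      using p by (simp add: powr_divide)
    also have "(s * r + x) powr (\<beta> - 1) * (s * r + x) powr 2 = (s * r + x) powr (\<beta> + 1)"
      by (simp add: add.commute flip: powr_add)
    also have "(1 - r) powr (\<beta> - 1) / (s * r + x) powr (\<beta> + 1) = f r"
      using powr_minus_divide[of "s * r + x" "\<beta> + 1"] by (simp add: f_def)
    finally show ?thesis .
  qed
  have C: "isCont f r" if "0 < r" "r < 1" for r
    unfolding f_def using that assms by (intro continuous_intros) (auto simp: add_pos_pos less_imp_neq[symmetric])
  have A: "((?F \<circ> real_of_ereal) \<longlongrightarrow> - (x powr (- \<beta>) / (\<beta> * (x + s)))) (at_right (ereal 0))"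
  proof -
    have "(?F \<longlongrightarrow> - (((1 - 0) / (s * 0 + x)) powr \<beta> / (\<beta> * (x + s)))) (at_right 0)"
      using assms by (intro tendsto_intros) auto
    then show ?thesis
      using assms by (simp add: ereal_tendsto_simps powr_divide powr_minus_divide)
  qed
  have B: "((?F \<circ> real_of_ereal) \<longlongrightarrow> 0) (at_left (ereal 1))"
  proof -
    have "\<forall>\<^sub>F r in at_left 1. (1 - r) / (s * r + x) \<ge> 0"
    proof (rule eventually_mono)
      show "\<forall>\<^sub>F r in at_left 1. r \<in> {0<..<1::real}" by (rule eventually_at_left_real) simp
    qed (use assms in auto)
    moreover have "((\<lambda>r. (1 - r) / (s * r + x)) \<longlongrightarrow> (1 - 1) / (s * 1 + x)) (at_left 1)"
      using assms by (intro tendsto_intros) auto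
    ultimately have "((\<lambda>r. ((1 - r) / (s * r + x)) powr \<beta>) \<longlongrightarrow> 0 powr \<beta>) (at_left 1)"
      using assms by (intro tendsto_powr') auto
    from tendsto_minus[OF tendsto_divide[OF this tendsto_const[of "\<beta> * (x + s)"]]]
    have "(?F \<longlongrightarrow> - (0 powr \<beta> / (\<beta> * (x + s)))) (at_left 1)"
      using assms by simp
    then show ?thesis by (simp add: ereal_tendsto_simps)
  qed
  have nn: "AE r in lborel. ereal 0 < ereal r \<longrightarrow> ereal r < ereal 1 \<longrightarrow> 0 \<le> f r"
    by (simp add: f_def)
  have "set_integrable lborel (einterval (ereal 0) (ereal 1)) f"
    by (rule interval_integral_FTC_nonneg(1)[OF _ _ _ nn A B]) (auto intro: D C)
  then show "set_integrable lborel {0<..<1} f" unfolding e .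
  have "(LBINT r=ereal 0..ereal 1. f r) = 0 - - (x powr (- \<beta>) / (\<beta> * (x + s)))"
    by (rule interval_integral_FTC_nonneg(2)[OF _ _ _ nn A B]) (auto intro: D C)
  then show "(LINT r:{0<..<1}|lborel. f r) = x powr (- \<beta>) / (\<beta> * (x + s))"
    by (simp add: interval_lebesgue_integral_def e)
qed

text \<open>The derivative moves from the kernel (\<sigma> + x)^(-\<beta>) to y^2 /
  \<open>kden \<beta> y\<close> at y = x^\<beta>, which changes the kernel's exponent by
  one.\<close>

lemma integration_by_parts_kernel:
  fixes \<beta> \<sigma> :: real
  assumes "0 < \<beta>" "\<beta> < 1" "\<sigma> > 0"
  shows "(LINT x:{0<..}|lborel. 2 * \<beta> * (x powr (\<beta> - 1) * kfun \<beta> (x powr \<beta>) * (\<sigma> + x) powr (- \<beta>)))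
     = (LINT x:{0<..}|lborel. \<beta> * ((x powr \<beta>)\<^sup>2 / kden \<beta> (x powr \<beta>)) * (\<sigma> + x) powr (- \<beta> - 1))"
proof -
  let ?u = "\<lambda>x. 2 * \<beta> * (x powr (\<beta> - 1) * kfun \<beta> (x powr \<beta>) * (\<sigma> + x) powr (- \<beta>))"
  let ?v = "\<lambda>x. \<beta> * ((x powr \<beta>)\<^sup>2 / kden \<beta> (x powr \<beta>)) * (\<sigma> + x) powr (- \<beta> - 1)"
  \<comment> \<open>The boundary term: its first factor vanishes at 0 and stays bounded at infinity,
    where the second factor decays. Its derivative is \<open>?u x - ?v x\<close>.\<close>
  let ?F = "\<lambda>x. (x powr \<beta>)\<^sup>2 / kden \<beta> (x powr \<beta>) * (\<sigma> + x) powr (- \<beta>)"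
  have l: "kconst \<beta> > 0" using kconst_pos assms by auto
  have dp: "kden \<beta> y > 0" if "y \<ge> 0" for y using kden_pos that assms by auto
  have Pb: "(x powr \<beta>)\<^sup>2 / kden \<beta> (x powr \<beta>) \<le> (x powr \<beta>)\<^sup>2 / (kconst \<beta> * (1 + x powr \<beta>)\<^sup>2)" for x
  proof -
    have "1 + x powr \<beta> > 0" by (simp add: add_pos_nonneg)
    then show ?thesis
    using kden_ge[of \<beta> "x powr \<beta>"] l dp[of "x powr \<beta>"] by (intro divide_left_mono mult_pos_pos) auto
  qed
  have e: "einterval (ereal 0) \<infinity> = {0<..}" by (auto simp: einterval_def)
  have iu: "set_integrable lborel {0<..} ?u"
  proof (rule set_integrable_bound)
    show "set_integrable lborel {0<..} (\<lambda>x. (2 * \<beta> * (1 / (kconst \<beta>)\<^sup>2) * \<sigma> powr (- \<beta>)) * (x powr (\<beta> - 1) / (1 + x powr \<beta>)\<^sup>2))"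
      by (intro set_integrable_mult_right powr_kernel_integrable assms)
    show "AE x in lborel. x \<in> {0<..} \<longrightarrow> norm (?u x) \<le> norm ((2 * \<beta> * (1 / (kconst \<beta>)\<^sup>2) * \<sigma> powr (- \<beta>)) * (x powr (\<beta> - 1) / (1 + x powr \<beta>)\<^sup>2))"
    proof (intro AE_I2 impI)
      fix x :: real assume x: "x \<in> {0<..}"
      have "norm (?u x) = 2 * \<beta> * (x powr (\<beta> - 1) * \<bar>kfun \<beta> (x powr \<beta>)\<bar> * (\<sigma> + x) powr (- \<beta>))"
        using assms by (simp add: abs_mult)
      also have "\<dots> \<le> 2 * \<beta> * (x powr (\<beta> - 1) * (1 / (kconst \<beta>)\<^sup>2 / (1 + x powr \<beta>)\<^sup>2) * \<sigma> powr (- \<beta>))"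
        using assms x kfun_bound[of \<beta> "x powr \<beta>"] by (intro mult_left_mono mult_mono powr_mono2') auto
      also have "\<dots> = (2 * \<beta> * (1 / (kconst \<beta>)\<^sup>2) * \<sigma> powr (- \<beta>)) * (x powr (\<beta> - 1) / (1 + x powr \<beta>)\<^sup>2)" by simp
      also have "\<dots> \<le> norm \<dots>" by (simp only: real_norm_def abs_ge_self)
      finally show "norm (?u x) \<le> norm ((2 * \<beta> * (1 / (kconst \<beta>)\<^sup>2) * \<sigma> powr (- \<beta>)) * (x powr (\<beta> - 1) / (1 + x powr \<beta>)\<^sup>2))" .
    qed
  qed (auto simp: set_borel_measurable_def)
  have iv: "set_integrable lborel {0<..} ?v"
  proof (rule set_integrable_bound)
    show "set_integrable lborel {0<..} (\<lambda>x. \<beta> / kconst \<beta> * (x powr (\<beta> - 1) / (1 + x powr \<beta>)\<^sup>2))"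
      by (intro set_integrable_mult_right powr_kernel_integrable assms)
    show "AE x in lborel. x \<in> {0<..} \<longrightarrow> norm (?v x) \<le> norm (\<beta> / kconst \<beta> * (x powr (\<beta> - 1) / (1 + x powr \<beta>)\<^sup>2))"
    proof (intro AE_I2 impI)
      fix x :: real assume x: "x \<in> {0<..}"
      have "norm (?v x) = ?v x" using assms dp[of "x powr \<beta>"] by (simp add: abs_mult)
      also have "\<dots> \<le> \<beta> * ((x powr \<beta>)\<^sup>2 / (kconst \<beta> * (1 + x powr \<beta>)\<^sup>2)) * x powr (- \<beta> - 1)"
        using assms x l Pb[of x] by (intro mult_left_mono mult_mono powr_mono2') auto
      also have "\<dots> = \<beta> / kconst \<beta> * ((x powr \<beta>)\<^sup>2 * x powr (- \<beta> - 1) / (1 + x powr \<beta>)\<^sup>2)"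
        by simp
      also have "(x powr \<beta>)\<^sup>2 * x powr (- \<beta> - 1) = x powr (\<beta> - 1)"
        using x by (simp add: power2_eq_square flip: powr_add)
      also have "\<beta> / kconst \<beta> * (x powr (\<beta> - 1) / (1 + x powr \<beta>)\<^sup>2) \<le> norm (\<beta> / kconst \<beta> * (x powr (\<beta> - 1) / (1 + x powr \<beta>)\<^sup>2))"
        by (simp only: real_norm_def abs_ge_self)
      finally show "norm (?v x) \<le> norm (\<beta> / kconst \<beta> * (x powr (\<beta> - 1) / (1 + x powr \<beta>)\<^sup>2))" .
    qed
  qed (auto simp: set_borel_measurable_def)
  have D: "DERIV ?F x :> ?u x - ?v x" if x: "0 < x" for x
  proof -
    let ?y = "x powr \<beta>"
    have d: "kden \<beta> ?y > 0" by (intro dp) simp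
    have 1: "DERIV (\<lambda>y. y\<^sup>2 / kden \<beta> y) ?y :> 2 * kfun \<beta> ?y"
    proof -
      have "DERIV (\<lambda>y. kden \<beta> y) ?y :> 2 * ?y + 2 * cos (pi * \<beta>)"
        unfolding kden_def by (auto intro!: derivative_eq_intros)
      then have "DERIV (\<lambda>y. y\<^sup>2 / kden \<beta> y) ?y :> (2 * ?y * kden \<beta> ?y - ?y\<^sup>2 * (2 * ?y + 2 * cos (pi * \<beta>))) / (kden \<beta> ?y)\<^sup>2"
        using d by (auto intro!: derivative_eq_intros simp: power2_eq_square)
      moreover have "2 * ?y * kden \<beta> ?y - ?y\<^sup>2 * (2 * ?y + 2 * cos (pi * \<beta>)) = 2 * (?y * (1 + cos (pi * \<beta>) * ?y))"
        unfolding kden_def by algebra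
      ultimately show ?thesis by (simp add: kfun_def)
    qed
    have 2: "DERIV (\<lambda>x. x powr \<beta>) x :> \<beta> * x powr (\<beta> - 1)"
      using x by (auto intro!: derivative_eq_intros)
    have 3: "DERIV (\<lambda>x. (\<sigma> + x) powr (- \<beta>)) x :> - \<beta> * (\<sigma> + x) powr (- \<beta> - 1)"
      using x assms by (auto intro!: derivative_eq_intros)
    have "DERIV ?F x :> 2 * kfun \<beta> ?y * (\<beta> * x powr (\<beta> - 1)) * (\<sigma> + x) powr (- \<beta>) + (- \<beta> * (\<sigma> + x) powr (- \<beta> - 1)) * (?y\<^sup>2 / kden \<beta> ?y)"
      by (rule DERIV_mult[OF DERIV_chain2[OF 1 2] 3])
    then show ?thesis by (simp add: mult_ac)
  qed
  have C: "isCont (\<lambda>x. ?u x - ?v x) x" if x: "0 < x" for x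
  proof -
    have "kden \<beta> (x powr \<beta>) > 0" by (intro dp) simp
    then show ?thesis unfolding kfun_def using x assms unfolding kden_def
      by (intro continuous_intros) auto
  qed
  have A: "((?F \<circ> real_of_ereal) \<longlongrightarrow> 0) (at_right (ereal 0))"
  proof -
    have "((\<lambda>x::real. x powr \<beta>) \<longlongrightarrow> 0 powr \<beta>) (at_right 0)"
      using assms by (intro tendsto_powr') (auto simp: eventually_at_right_less eventually_at_filter)
    then have y: "((\<lambda>x::real. x powr \<beta>) \<longlongrightarrow> 0) (at_right 0)" by simp
    then have "(?F \<longlongrightarrow> 0\<^sup>2 / (0\<^sup>2 + 2 * cos (pi * \<beta>) * 0 + 1) * (\<sigma> + 0) powr (- \<beta>)) (at_right 0)"
      unfolding kden_def using assms by (intro tendsto_intros y) auto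
    then show ?thesis by (simp add: ereal_tendsto_simps)
  qed
  have B: "((?F \<circ> real_of_ereal) \<longlongrightarrow> 0) (at_left \<infinity>)"
  proof -
    have "(?F \<longlongrightarrow> 0) at_top"
    proof (rule Lim_null_comparison)
      show "\<forall>\<^sub>F x in at_top. norm (?F x) \<le> 1 / kconst \<beta> * x powr (- \<beta>)"
        using eventually_gt_at_top[of 0]
      proof eventually_elim
        fix x :: real assume x: "x > 0"
        have "(x powr \<beta>)\<^sup>2 \<le> (1 + x powr \<beta>)\<^sup>2" by (intro power_mono) auto
        moreover have "1 + x powr \<beta> > 0" by (simp add: add_pos_nonneg)
        ultimately have "(x powr \<beta>)\<^sup>2 / (kconst \<beta> * (1 + x powr \<beta>)\<^sup>2) \<le> 1 / kconst \<beta>"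
          using l by (simp add: divide_simps)
        then have P: "(x powr \<beta>)\<^sup>2 / kden \<beta> (x powr \<beta>) \<le> 1 / kconst \<beta>" using Pb[of x] by linarith
        have "norm (?F x) = ?F x" using dp[of "x powr \<beta>"] by (simp add: abs_mult)
        also have "\<dots> \<le> 1 / kconst \<beta> * x powr (- \<beta>)"
          using P x assms l by (intro mult_mono powr_mono2') auto
        finally show "norm (?F x) \<le> 1 / kconst \<beta> * x powr (- \<beta>)" .
      qed
      have "((\<lambda>x::real. x powr (-\<beta>)) \<longlongrightarrow> 0) at_top"
        using assms by (intro tendsto_neg_powr filterlim_ident) auto
      then show "((\<lambda>x. 1 / kconst \<beta> * x powr (-\<beta>)) \<longlongrightarrow> 0) at_top"
        by (rule tendsto_mult_right_zero)
    qed
    then show ?thesis by (simp add: ereal_tendsto_simps)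
  qed
  have "(LBINT x=ereal 0..\<infinity>. ?u x - ?v x) = 0 - 0"
  proof (rule interval_integral_FTC_integrable[OF _ _ _ _ A B])
    show "set_integrable lborel (einterval (ereal 0) \<infinity>) (\<lambda>x. ?u x - ?v x)"
      unfolding e by (intro set_integral_diff iu iv)
    show "(?F has_vector_derivative ?u x - ?v x) (at x)" if "ereal 0 < ereal x" for x
      using D[of x] that by (simp only: has_real_derivative_iff_has_vector_derivative less_ereal.simps)
    show "isCont (\<lambda>x. ?u x - ?v x) x" if "ereal 0 < ereal x" for x
      using C[of x] that by simp
  qed auto
  then have "(LINT x:{0<..}|lborel. ?u x - ?v x) = 0"
    by (simp add: interval_lebesgue_integral_def e)
  then show ?thesis using set_integral_diff(2)[OF iu iv] by simp
qed

text \<open>The kernel supplies the second factor 1/(1 + t^\<beta>), since 1 + t^\<beta> \<le> (1 +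
  s^(-\<beta>)) (s + t)^\<beta>.\<close>

lemma phi_kernel_dominator_integrable:
  fixes \<beta> s :: real
  assumes "0 < \<beta>" "s > 0"
  shows "set_integrable lborel {0<..} (\<lambda>t. t powr (\<beta> - 1) / (1 + t powr \<beta>) * (s + t) powr (- \<beta>))"
proof (rule set_integrable_bound)
  show "set_integrable lborel {0<..} (\<lambda>t. (1 + s powr (- \<beta>)) * (t powr (\<beta> - 1) / (1 + t powr \<beta>)\<^sup>2))"
    by (intro set_integrable_mult_right powr_kernel_integrable assms)
  show "AE t in lborel. t \<in> {0<..} \<longrightarrow> norm (t powr (\<beta> - 1) / (1 + t powr \<beta>) * (s + t) powr (- \<beta>))
     \<le> norm ((1 + s powr (- \<beta>)) * (t powr (\<beta> - 1) / (1 + t powr \<beta>)\<^sup>2))"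
  proof (intro AE_I2 impI)
    fix t :: real assume t: "t \<in> {0<..}"
    have p: "1 + t powr \<beta> > 0" by (simp add: add_pos_nonneg)
    have "s powr (- \<beta>) * s powr \<beta> \<le> s powr (- \<beta>) * (s + t) powr \<beta>"
      using t assms by (intro mult_left_mono powr_mono2) auto
    moreover have "s powr (- \<beta>) * s powr \<beta> = 1" using assms by (simp flip: powr_add)
    moreover have "t powr \<beta> \<le> (s + t) powr \<beta>"
      using t assms by (intro powr_mono2) auto
    ultimately have "1 + t powr \<beta> \<le> (1 + s powr (- \<beta>)) * (s + t) powr \<beta>"
      by (simp add: algebra_simps)
    then have "(1 + t powr \<beta>) / (s + t) powr \<beta> \<le> 1 + s powr (- \<beta>)"
      using t assms by (simp add: divide_le_eq)
    then have "(s + t) powr (- \<beta>) \<le> (1 + s powr (- \<beta>)) / (1 + t powr \<beta>)"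
      using p t assms by (simp add: powr_minus_divide le_divide_eq)
    then have "t powr (\<beta> - 1) / (1 + t powr \<beta>) * (s + t) powr (- \<beta>) \<le>
      t powr (\<beta> - 1) / (1 + t powr \<beta>) * ((1 + s powr (- \<beta>)) / (1 + t powr \<beta>))"
      using p by (intro mult_left_mono) auto
    also have "\<dots> = (1 + s powr (- \<beta>)) * (t powr (\<beta> - 1) / (1 + t powr \<beta>)\<^sup>2)"
      by (simp add: power2_eq_square)
    also have "\<dots> \<le> norm \<dots>" by (simp only: real_norm_def abs_ge_self)
    finally show "norm (t powr (\<beta> - 1) / (1 + t powr \<beta>) * (s + t) powr (- \<beta>))
     \<le> norm ((1 + s powr (- \<beta>)) * (t powr (\<beta> - 1) / (1 + t powr \<beta>)\<^sup>2))"
      using p by (simp add: abs_mult)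
  qed
qed (auto simp: set_borel_measurable_def)

text \<open>Integrating \<open>K\<close> over r gives the wanted integrand; integrating
  \<open>G\<close> over r gives the order-one density by the Abel identity. For each fixed r the
  other two integrals agree, and two uses of Fubini join the ends.\<close>

lemma phi_beta_stieltjes:
  fixes \<beta> s :: real
  assumes "0 < \<beta>" "\<beta> < 1" "s > 0"
  shows "set_integrable lborel {0<..} (\<lambda>t. phi_beta \<beta> t * (s + t) powr (- \<beta>))"
    and "(LINT t:{0<..}|lborel. phi_beta \<beta> t * (s + t) powr (- \<beta>)) = 1 / (1 + s powr \<beta>)"
proof -
  define c where "c = 2 * \<beta> * sin (pi * \<beta>) / pi"
  define K where "K = (\<lambda>t r. indicat_real {0<..} t * indicat_real {0<..<1} r *
     (c * t powr (\<beta> - 1) * (kfun \<beta> ((t * r) powr \<beta>) * (1 - r) powr (\<beta> - 1)) * (s + t) powr (- \<beta>)))"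
  define G where "G = (\<lambda>x r. indicat_real {0<..} x * indicat_real {0<..<1} r *
     (sin (pi * \<beta>) / pi * \<beta> * ((x powr \<beta>)\<^sup>2 / kden \<beta> (x powr \<beta>)) * ((1 - r) powr (\<beta> - 1) * (s * r + x) powr (- \<beta> - 1))))"
  have c0: "c > 0" using assms sin_pi_pos[of \<beta>] by (simp add: c_def)
  have [measurable]: "case_prod K \<in> borel_measurable (lborel \<Otimes>\<^sub>M lborel)" unfolding K_def by measurable
  have [measurable]: "case_prod G \<in> borel_measurable (lborel \<Otimes>\<^sub>M lborel)" unfolding G_def by measurable
  \<comment> \<open>\<open>K\<close> may change sign through \<open>kfun\<close>, so absolute
    integrability comes from the separated product bound.\<close>
  have Kint: "integrable (lborel \<Otimes>\<^sub>M lborel) (case_prod K)"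
  proof (rule Bochner_Integration.integrable_bound)
    let ?a = "\<lambda>t. c * (1 / (kconst \<beta>)\<^sup>2) * (indicat_real {0<..} t *\<^sub>R (t powr (\<beta> - 1) / (1 + t powr \<beta>) * (s + t) powr (- \<beta>)))"
    let ?b = "\<lambda>r. indicat_real {0<..<1} r *\<^sub>R (r powr (- \<beta>) * (1 - r) powr (\<beta> - 1))"
    show "integrable (lborel \<Otimes>\<^sub>M lborel) (\<lambda>(t, r). ?a t * ?b r)"
    proof (rule integrable_product_lborel)
      show "integrable lborel ?a"
        using phi_kernel_dominator_integrable[OF assms(1,3)] unfolding set_integrable_def
        by (intro integrable_mult_right) auto
      show "integrable lborel ?b"
        using beta_kernel_integrable(1)[OF assms(1,2)] unfolding set_integrable_def .
    qed
    show "AE p in lborel \<Otimes>\<^sub>M lborel. norm (case_prod K p) \<le> norm (case p of (t, r) \<Rightarrow> ?a t * ?b r)"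
    proof (rule AE_I2)
      fix p :: "real \<times> real"
      obtain t r where p: "p = (t, r)" by (cases p)
      show "norm (case_prod K p) \<le> norm (case p of (t, r) \<Rightarrow> ?a t * ?b r)"
      proof (cases "t > 0 \<and> 0 < r \<and> r < 1")
        case True
        have "norm (K t r) = c * t powr (\<beta> - 1) * \<bar>kfun \<beta> ((t * r) powr \<beta>) * (1 - r) powr (\<beta> - 1)\<bar> * (s + t) powr (- \<beta>)"
          using True c0 by (simp add: K_def abs_mult)
        also have "\<dots> \<le> c * t powr (\<beta> - 1) * (1 / (kconst \<beta>)\<^sup>2 / (1 + t powr \<beta>) * (r powr (-\<beta>) * (1 - r) powr (\<beta> - 1))) * (s + t) powr (- \<beta>)"
          using True c0 phi_integrand_bound[of \<beta> t r] assms by (intro mult_right_mono mult_left_mono) auto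
        also have "\<dots> = ?a t * ?b r" using True by simp
        also have "\<dots> \<le> norm \<dots>" by (simp only: real_norm_def abs_ge_self)
        finally show ?thesis by (simp add: p)
      next
        case False
        then have "K t r = 0" by (auto simp: K_def)
        then show ?thesis by (simp add: p)
      qed
    qed
  qed measurable
  have Kr: "(LINT r|lborel. K t r) = indicator {0<..} t *\<^sub>R (phi_beta \<beta> t * (s + t) powr (- \<beta>))" for t
  proof (cases "t > 0")
    case True
    have "(LINT r|lborel. K t r) = (LINT r|lborel. (c * t powr (\<beta> - 1) * (s + t) powr (- \<beta>)) *
        (indicator {0<..<1} r *\<^sub>R (kfun \<beta> ((t * r) powr \<beta>) * (1 - r) powr (\<beta> - 1))))"
      using True by (intro Bochner_Integration.integral_cong) (auto simp: K_def)
    also have "\<dots> = (c * t powr (\<beta> - 1) * (s + t) powr (- \<beta>)) *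
        (LINT r:{0<..<1}|lborel. kfun \<beta> ((t * r) powr \<beta>) * (1 - r) powr (\<beta> - 1))"
      unfolding set_lebesgue_integral_def by (rule integral_mult_right_zero)
    also have "\<dots> = phi_beta \<beta> t * (s + t) powr (- \<beta>)"
      using True by (simp add: phi_beta_alt c_def)
    finally show ?thesis using True by simp
  qed (simp add: K_def)
  show "set_integrable lborel {0<..} (\<lambda>t. phi_beta \<beta> t * (s + t) powr (- \<beta>))"
    using lborel_pair.integrable_fst[OF Kint] unfolding Kr set_integrable_def .
  have Gint: "integrable (lborel \<Otimes>\<^sub>M lborel) (case_prod G)"
    and Gr: "\<And>x. (LINT r|lborel. G x r) = indicator {0<..} x *\<^sub>R (sin (pi * \<beta>) / pi * (x powr \<beta> / kden \<beta> (x powr \<beta>)) / (x + s))"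
  proof -
    \<comment> \<open>Since \<open>G\<close> is nonnegative, its product integrability reduces to
      integrability of the order-one density, and no separate estimate is required.\<close>
    have G0: "G x r \<ge> 0" for x r
      using sin_pi_pos[of \<beta>] assms kden_pos[of \<beta> "x powr \<beta>"] by (auto simp: G_def intro!: mult_nonneg_nonneg)
    have Gx: "integrable lborel (G x)"
      "(LINT r|lborel. G x r) = indicator {0<..} x *\<^sub>R (sin (pi * \<beta>) / pi * (x powr \<beta> / kden \<beta> (x powr \<beta>)) / (x + s))" for x
    proof -
      let ?e = "indicat_real {0<..} x * (sin (pi * \<beta>) / pi * \<beta> * ((x powr \<beta>)\<^sup>2 / kden \<beta> (x powr \<beta>)))"
      let ?f = "\<lambda>r. (1 - r) powr (\<beta> - 1) * (s * r + x) powr (- \<beta> - 1)"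
      have eq: "G x = (\<lambda>r. ?e * (indicator {0<..<1} r *\<^sub>R ?f r))"
        by (simp add: G_def fun_eq_iff)
      show "integrable lborel (G x)"
      proof (cases "x > 0")
        case True
        then show ?thesis
          using abel_kernel_integral(1)[of \<beta> s x] assms unfolding eq set_integrable_def
          by (intro integrable_mult_right) auto
      qed (simp add: G_def)
      show "(LINT r|lborel. G x r) = indicator {0<..} x *\<^sub>R (sin (pi * \<beta>) / pi * (x powr \<beta> / kden \<beta> (x powr \<beta>)) / (x + s))"
      proof (cases "x > 0")
        case True
        have "(LINT r|lborel. G x r) = ?e * (LINT r:{0<..<1}|lborel. ?f r)"
          unfolding eq set_lebesgue_integral_def by (rule integral_mult_right_zero)
        also have "\<dots> = ?e * (x powr (- \<beta>) / (\<beta> * (x + s)))"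
          using abel_kernel_integral(2)[of \<beta> s x] True assms by simp
        also have "\<dots> = sin (pi * \<beta>) / pi * ((x powr \<beta>)\<^sup>2 * x powr (- \<beta>) / kden \<beta> (x powr \<beta>)) / (x + s)"
          using True assms by simp
        also have "(x powr \<beta>)\<^sup>2 * x powr (- \<beta>) = x powr \<beta>"
          using True by (simp add: power2_eq_square flip: powr_add)
        finally show ?thesis using True by simp
      qed (simp add: G_def)
    qed
    show "\<And>x. (LINT r|lborel. G x r) = indicator {0<..} x *\<^sub>R (sin (pi * \<beta>) / pi * (x powr \<beta> / kden \<beta> (x powr \<beta>)) / (x + s))"
      by (rule Gx(2))
    show "integrable (lborel \<Otimes>\<^sub>M lborel) (case_prod G)"
    proof (rule lborel_pair.Fubini_integrable)
      have "(\<lambda>x. LINT r|lborel. norm (case_prod G (x, r))) = (\<lambda>x. LINT r|lborel. G x r)"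
        using G0 by simp
      then show "integrable lborel (\<lambda>x. LINT r|lborel. norm (case_prod G (x, r)))"
        using stieltjes_kernel_order_one(1)[OF assms] unfolding Gx(2) set_integrable_def by simp
    qed (use Gx(1) in auto)
  qed
  \<comment> \<open>The substitution t = x/r frees \<open>kfun\<close> from r and turns the kernel
    into one with parameter s r. Integration by parts at \<open>\<sigma> = s * r\<close> then
    applies.\<close>
  have inner: "(LINT t|lborel. K t r) = (LINT x|lborel. G x r)" for r
  proof (cases "0 < r \<and> r < 1")
    case r: True
    let ?b = "(1 - r) powr (\<beta> - 1)"
    have "(LINT t|lborel. K t r) = \<bar>1 / r\<bar> *\<^sub>R (LINT x|lborel. K (0 + 1 / r * x) r)"
      using r by (intro lborel_integral_real_affine) auto
    also have "\<dots> = (LINT x|lborel. \<bar>1 / r\<bar> *\<^sub>R K (0 + 1 / r * x) r)" by simp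
    also have "\<dots> = (LINT x|lborel. (sin (pi * \<beta>) / pi * ?b) * (indicator {0<..} x *\<^sub>R (2 * \<beta> * (x powr (\<beta> - 1) * kfun \<beta> (x powr \<beta>) * (s * r + x) powr (- \<beta>)))))"
    proof (intro Bochner_Integration.integral_cong refl)
      fix x :: real
      show "\<bar>1 / r\<bar> *\<^sub>R K (0 + 1 / r * x) r = (sin (pi * \<beta>) / pi * ?b) * (indicator {0<..} x *\<^sub>R (2 * \<beta> * (x powr (\<beta> - 1) * kfun \<beta> (x powr \<beta>) * (s * r + x) powr (- \<beta>))))"
      proof (cases "x > 0")
        case True
        have k1: "s + 1 / r * x = (s * r + x) / r" using r by (simp add: field_simps)
        have k2: "((s * r + x) / r) powr (- \<beta>) = (s * r + x) powr (- \<beta>) * r powr \<beta>"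
          using r True assms by (simp add: powr_divide powr_minus_divide add_nonneg_nonneg)
        have k3: "(1 / r * x) powr (\<beta> - 1) = x powr (\<beta> - 1) * r powr (1 - \<beta>)"
          using r True powr_minus_divide[of r "1 - \<beta>"] by (simp add: powr_divide)
        \<comment> \<open>The Jacobian 1/r cancels the powers of r coming from t^(\<beta>-1) and
          from the kernel.\<close>
        have k4: "1 / r * (r powr (1 - \<beta>) * r powr \<beta>) = 1"
          using r by (simp flip: powr_add)
        have "\<bar>1 / r\<bar> *\<^sub>R K (0 + 1 / r * x) r = 1 / r * (c * (1 / r * x) powr (\<beta> - 1) * (kfun \<beta> (x powr \<beta>) * ?b) * (s + 1 / r * x) powr (- \<beta>))"
          using r True by (simp add: K_def)
        also have "\<dots> = (1 / r * (r powr (1 - \<beta>) * r powr \<beta>)) * (c * x powr (\<beta> - 1) * (kfun \<beta> (x powr \<beta>) * ?b) * (s * r + x) powr (- \<beta>))"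
          unfolding k1 k2 k3 by (simp only: mult_ac)
        also have "\<dots> = c * x powr (\<beta> - 1) * (kfun \<beta> (x powr \<beta>) * ?b) * (s * r + x) powr (- \<beta>)"
          unfolding k4 by simp
        finally show ?thesis using True by (simp add: c_def)
      next
        case False
        then have "\<not> 0 < 1 / r * x" using r by (simp add: zero_less_divide_iff)
        then show ?thesis using False by (simp add: K_def)
      qed
    qed
    also have "\<dots> = (sin (pi * \<beta>) / pi * ?b) * (LINT x:{0<..}|lborel. 2 * \<beta> * (x powr (\<beta> - 1) * kfun \<beta> (x powr \<beta>) * (s * r + x) powr (- \<beta>)))"
      unfolding set_lebesgue_integral_def by (rule integral_mult_right_zero)
    also have "(LINT x:{0<..}|lborel. 2 * \<beta> * (x powr (\<beta> - 1) * kfun \<beta> (x powr \<beta>) * (s * r + x) powr (- \<beta>))) =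
       (LINT x:{0<..}|lborel. \<beta> * ((x powr \<beta>)\<^sup>2 / kden \<beta> (x powr \<beta>)) * (s * r + x) powr (- \<beta> - 1))"
      using r assms by (intro integration_by_parts_kernel) auto
    also have "(sin (pi * \<beta>) / pi * ?b) * \<dots> = (LINT x|lborel. (sin (pi * \<beta>) / pi * ?b) * (indicator {0<..} x *\<^sub>R (\<beta> * ((x powr \<beta>)\<^sup>2 / kden \<beta> (x powr \<beta>)) * (s * r + x) powr (- \<beta> - 1))))"
      unfolding set_lebesgue_integral_def by (rule integral_mult_right_zero[symmetric])
    also have "\<dots> = (LINT x|lborel. G x r)"
      using r by (intro Bochner_Integration.integral_cong refl) (simp add: G_def)
    finally show ?thesis .
  qed (auto simp: K_def G_def)
  have "(LINT t:{0<..}|lborel. phi_beta \<beta> t * (s + t) powr (- \<beta>)) = (LINT t|lborel. LINT r|lborel. K t r)"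
    unfolding Kr set_lebesgue_integral_def ..
  also have "\<dots> = (LINT r|lborel. LINT t|lborel. K t r)"
    by (rule lborel_pair.Fubini_integral[OF Kint, symmetric])
  also have "\<dots> = (LINT r|lborel. LINT x|lborel. G x r)" unfolding inner ..
  also have "\<dots> = (LINT x|lborel. LINT r|lborel. G x r)"
    by (rule lborel_pair.Fubini_integral[OF Gint])
  also have "\<dots> = 1 / (1 + s powr \<beta>)"
    using stieltjes_kernel_order_one(2)[OF assms] unfolding Gr set_lebesgue_integral_def .
  finally show "(LINT t:{0<..}|lborel. phi_beta \<beta> t * (s + t) powr (- \<beta>)) = 1 / (1 + s powr \<beta>)" .
qed

section \<open>Integration against the representing measure\<close>

lemma stieltjes_measure_id_measurable:
  assumes "stieltjes_measure \<alpha> \<mu>"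
  shows "(\<lambda>x. x) \<in> measurable \<mu> borel" "space \<mu> = {0..}" "{0} \<in> sets \<mu>" "{0<..} \<in> sets \<mu>"
proof -
  have s: "sets \<mu> = sets (restrict_space borel {0..})" using assms by (simp add: stieltjes_measure_def)
  show "(\<lambda>x. x) \<in> measurable \<mu> borel"
    unfolding measurable_cong_sets[OF s refl] by (intro measurable_restrict_space1) simp
  show sp: "space \<mu> = {0..}" using sets_eq_imp_space_eq[OF s] by (simp add: space_restrict_space)
  show "{0} \<in> sets \<mu>" "{0<..} \<in> sets \<mu>" unfolding s by (auto simp: sets_restrict_space_iff)
qed

text \<open>On [0,b] the weight is at least (1+b)^(-\<alpha>), so its finite integral controls the
  mass. This gives sigma-finiteness for Tonelli and a finite atom at 0.\<close>

lemma stieltjes_measure_atMost_finite: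
  assumes "stieltjes_measure \<alpha> \<mu>" "\<alpha> \<ge> 0"
  shows "emeasure \<mu> {0..b} < \<infinity>"
proof -
  note [measurable] = stieltjes_measure_id_measurable(1)[OF assms(1)]
  have s: "sets \<mu> = sets (restrict_space borel {0..})"
    and fin: "(\<integral>\<^sup>+ t. ennreal ((1 + t) powr (-\<alpha>)) \<partial>\<mu>) < \<infinity>" using assms by (simp_all add: stieltjes_measure_def)
  have A: "{0..b} \<in> sets \<mu>" unfolding s by (auto simp: sets_restrict_space_iff)
  have "emeasure \<mu> {0..b} = (\<integral>\<^sup>+ t. indicator {0..b} t \<partial>\<mu>)" using A by simp
  also have "\<dots> \<le> (\<integral>\<^sup>+ t. ennreal ((1 + b) powr \<alpha>) * ennreal ((1 + t) powr (-\<alpha>)) \<partial>\<mu>)"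
  proof (rule nn_integral_mono)
    fix t
    show "indicator {0..b} t \<le> ennreal ((1 + b) powr \<alpha>) * ennreal ((1 + t) powr (-\<alpha>))"
    proof (cases "t \<in> {0..b}")
      case True
      have "1 = (1 + t) powr \<alpha> * (1 + t) powr (- \<alpha>)" using True by (simp flip: powr_add)
      also have "\<dots> \<le> (1 + b) powr \<alpha> * (1 + t) powr (- \<alpha>)"
        using True assms by (intro mult_right_mono powr_mono2) auto
      finally show ?thesis using True by (simp flip: ennreal_mult add: one_ennreal_def[symmetric] ennreal_leI flip: ennreal_1)
    qed simp
  qed
  also have "\<dots> = ennreal ((1 + b) powr \<alpha>) * (\<integral>\<^sup>+ t. ennreal ((1 + t) powr (-\<alpha>)) \<partial>\<mu>)"
    by (rule nn_integral_cmult) measurable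
  also have "\<dots> < \<infinity>" using fin by (simp add: ennreal_mult_less_top)
  finally show ?thesis .
qed

lemma stieltjes_measure_sigma_finite:
  assumes "stieltjes_measure \<alpha> \<mu>" "\<alpha> \<ge> 0"
  shows "sigma_finite_measure \<mu>"
proof
  have s: "sets \<mu> = sets (restrict_space borel {0..})" using assms by (simp add: stieltjes_measure_def)
  show "\<exists>A. countable A \<and> A \<subseteq> sets \<mu> \<and> \<Union> A = space \<mu> \<and> (\<forall>a\<in>A. emeasure \<mu> a \<noteq> \<infinity>)"
  proof (intro exI[of _ "range (\<lambda>n::nat. {0..real n})"] conjI)
    show "range (\<lambda>n::nat. {0..real n}) \<subseteq> sets \<mu>" unfolding s by (auto simp: sets_restrict_space_iff)
    show "\<Union> (range (\<lambda>n::nat. {0..real n})) = space \<mu>"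
      unfolding stieltjes_measure_id_measurable(2)[OF assms(1)] by (auto intro: real_arch_simple)
    show "\<forall>a\<in>range (\<lambda>n::nat. {0..real n}). emeasure \<mu> a \<noteq> \<infinity>"
      using stieltjes_measure_atMost_finite[OF assms] by (auto simp: less_top[symmetric])
  qed auto
qed

lemma stieltjes_measure_one_integrable:
  assumes "stieltjes_measure 1 \<mu>" "z > 0"
  shows "integrable \<mu> (\<lambda>t. 1 / (z + t))"
proof -
  note [measurable] = stieltjes_measure_id_measurable(1)[OF assms(1)]
  have fin: "(\<integral>\<^sup>+ t. ennreal ((1 + t) powr (-1)) \<partial>\<mu>) < \<infinity>" using assms by (simp add: stieltjes_measure_def)
  have "integrable \<mu> (\<lambda>t. (1 + t) powr (-1))"
    using fin by (intro integrableI_nonneg) auto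
  then have "integrable \<mu> (\<lambda>t. (1 + 1 / z) * (1 + t) powr (-1))" by (rule integrable_mult_right)
  then show ?thesis
  proof (rule Bochner_Integration.integrable_bound)
    show "AE t in \<mu>. norm (1 / (z + t)) \<le> norm ((1 + 1 / z) * (1 + t) powr (-1))"
    proof (rule AE_I2)
      fix t assume "t \<in> space \<mu>"
      then have t: "t \<ge> 0" unfolding stieltjes_measure_id_measurable(2)[OF assms(1)] by simp
      have "1 + t \<le> (1 + 1 / z) * (z + t)" using t assms by (simp add: field_simps)
      then have "(1 + t) / (z + t) \<le> 1 + 1 / z"
        using t assms by (subst pos_divide_le_eq) auto
      then have "(1 + t) / (z + t) * (1 / (1 + t)) \<le> (1 + 1 / z) * (1 / (1 + t))"
        using t by (intro mult_right_mono) auto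
      then show "norm (1 / (z + t)) \<le> norm ((1 + 1 / z) * (1 + t) powr (-1))"
        using t assms by (simp add: powr_minus_divide abs_mult)
    qed
  qed measurable
qed

text \<open>Homogeneity: r = p t with p^\<beta> = \<tau> reduces to the case \<tau> = 1 at the point
  s/p, and the kernel releases p^(-\<beta>) = 1/\<tau>. Positivity of \<open>phi_beta\<close> turns
  the Bochner value into a nonnegative integral.\<close>

lemma phi_beta_scaled:
  assumes "0 < \<beta>" "\<beta> < 1" "\<tau> > 0" "s > 0"
  shows "(\<integral>\<^sup>+ r. ennreal (indicator {0<..} r * (phi_beta \<beta> (r / \<tau> powr (1/\<beta>)) / \<tau> powr (1/\<beta>) * (s + r) powr (- \<beta>))) \<partial>lborel)
    = ennreal (1 / (s powr \<beta> + \<tau>))"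
proof -
  define p where "p = \<tau> powr (1 / \<beta>)"
  have p: "p > 0" using assms by (simp add: p_def)
  have pb: "p powr \<beta> = \<tau>" using assms by (simp add: p_def powr_powr)
  let ?g = "\<lambda>t. indicat_real {0<..} t *\<^sub>R (phi_beta \<beta> t * (s / p + t) powr (- \<beta>))"
  have g: "integrable lborel ?g" "integral\<^sup>L lborel ?g = 1 / (1 + (s / p) powr \<beta>)"
    using phi_beta_stieltjes[of \<beta> "s / p"] assms p
    unfolding set_integrable_def set_lebesgue_integral_def by auto
  have ng: "?g t \<ge> 0" for t using phi_beta_nonneg[OF assms(1,2), of t] by (auto simp: indicator_def)
  have "(\<integral>\<^sup>+ r. ennreal (indicator {0<..} r * (phi_beta \<beta> (r / p) / p * (s + r) powr (- \<beta>))) \<partial>lborel)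
     = \<bar>p\<bar> * (\<integral>\<^sup>+ x. ennreal (indicator {0<..} (0 + p * x) * (phi_beta \<beta> ((0 + p * x) / p) / p * (s + (0 + p * x)) powr (- \<beta>))) \<partial>lborel)"
    using p by (intro nn_integral_real_affine) auto
  also have "\<dots> = (\<integral>\<^sup>+ x. ennreal p * ennreal (indicator {0<..} (0 + p * x) * (phi_beta \<beta> ((0 + p * x) / p) / p * (s + (0 + p * x)) powr (- \<beta>))) \<partial>lborel)"
    using p by (subst nn_integral_cmult) auto
  also have "\<dots> = (\<integral>\<^sup>+ x. ennreal (1 / \<tau> * ?g x) \<partial>lborel)"
  proof (intro nn_integral_cong)
    fix x :: real
    show "ennreal p * ennreal (indicator {0<..} (0 + p * x) * (phi_beta \<beta> ((0 + p * x) / p) / p * (s + (0 + p * x)) powr (- \<beta>))) = ennreal (1 / \<tau> * ?g x)"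
    proof (cases "x > 0")
      case True
      have "s + p * x = p * (s / p + x)" using p by (simp add: field_simps)
      then have "(s + p * x) powr (- \<beta>) = p powr (- \<beta>) * (s / p + x) powr (- \<beta>)"
        using p True assms by (simp only: powr_mult)
      also have "p powr (- \<beta>) = 1 / \<tau>" by (simp add: powr_minus_divide pb)
      finally show ?thesis using True p by (simp flip: ennreal_mult')
    next
      case False
      then have "\<not> 0 < p * x" using p by (simp add: zero_less_mult_iff)
      then show ?thesis using False by simp
    qed
  qed
  also have "\<dots> = ennreal (LINT x|lborel. 1 / \<tau> * ?g x)"
    using g(1) ng assms by (intro nn_integral_eq_integral integrable_mult_right AE_I2 mult_nonneg_nonneg) auto
  also have "(LINT x|lborel. 1 / \<tau> * ?g x) = 1 / \<tau> * (1 / (1 + (s / p) powr \<beta>))"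
    unfolding g(2)[symmetric] by (rule integral_mult_right_zero)
  also have "(s / p) powr \<beta> = s powr \<beta> / \<tau>" using assms p by (simp add: powr_divide pb)
  also have "1 / \<tau> * (1 / (1 + s powr \<beta> / \<tau>)) = 1 / (s powr \<beta> + \<tau>)"
    using assms by (simp add: field_simps)
  finally show ?thesis unfolding p_def .
qed

text \<open>For fixed r the bound is a constant times the order-one Stieltjes kernel at z =
  r^\<beta>, hence integrable against \<open>\<mu>\<close>.\<close>

lemma phi_beta_scaled_bound:
  assumes "0 < \<beta>" "\<beta> < 1"
  obtains C where "C \<ge> 0" "\<And>r \<tau>. r > 0 \<Longrightarrow> \<tau> > 0 \<Longrightarrow>
    \<bar>phi_beta \<beta> (r / \<tau> powr (1/\<beta>)) / \<tau> powr (1/\<beta>)\<bar> \<le> C * r powr (\<beta> - 1) * (1 / (r powr \<beta> + \<tau>))"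
proof -
  obtain C where C: "C \<ge> 0" "\<And>t. t > 0 \<Longrightarrow> \<bar>phi_beta \<beta> t\<bar> \<le> C * (t powr (\<beta> - 1) / (1 + t powr \<beta>))"
    using phi_beta_bound[OF assms] by blast
  have "\<bar>phi_beta \<beta> (r / \<tau> powr (1/\<beta>)) / \<tau> powr (1/\<beta>)\<bar> \<le> C * r powr (\<beta> - 1) * (1 / (r powr \<beta> + \<tau>))"
    if "r > 0" "\<tau> > 0" for r \<tau>
  proof -
    define p where "p = \<tau> powr (1 / \<beta>)"
    have p: "p > 0" using that by (simp add: p_def)
    have pb: "p powr \<beta> = \<tau>" using that assms by (simp add: p_def powr_powr)
    have pb1: "p powr (\<beta> - 1) = \<tau> / p" using p by (simp add: powr_diff pb)
    have "\<bar>phi_beta \<beta> (r / p) / p\<bar> = \<bar>phi_beta \<beta> (r / p)\<bar> / p" using p by simp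
    also have "\<dots> \<le> C * ((r / p) powr (\<beta> - 1) / (1 + (r / p) powr \<beta>)) / p"
      using C(2)[of "r / p"] that p by (intro divide_right_mono) auto
    also have "\<dots> = C * r powr (\<beta> - 1) * (1 / (r powr \<beta> + \<tau>))"
    proof -
      have "1 + r powr \<beta> / \<tau> = (r powr \<beta> + \<tau>) / \<tau>" using that by (simp add: field_simps)
      then show ?thesis using that p by (simp add: powr_divide pb pb1)
    qed
    finally show ?thesis unfolding p_def .
  qed
  then show ?thesis using that C(1) by blast
qed

lemma psi_beta_integrable:
  assumes "stieltjes_measure 1 \<mu>" "0 < \<beta>" "\<beta> < 1" "r > 0"
  shows "set_integrable \<mu> {0<..} (\<lambda>\<tau>. phi_beta \<beta> (r / \<tau> powr (1/\<beta>)) / \<tau> powr (1/\<beta>))"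
proof -
  note [measurable] = stieltjes_measure_id_measurable(1,4)[OF assms(1)]
  obtain C where C: "C \<ge> 0" "\<And>r \<tau>. r > 0 \<Longrightarrow> \<tau> > 0 \<Longrightarrow>
    \<bar>phi_beta \<beta> (r / \<tau> powr (1/\<beta>)) / \<tau> powr (1/\<beta>)\<bar> \<le> C * r powr (\<beta> - 1) * (1 / (r powr \<beta> + \<tau>))"
    using phi_beta_scaled_bound[OF assms(2,3)] by blast
  show ?thesis unfolding set_integrable_def
  proof (rule Bochner_Integration.integrable_bound)
    show "integrable \<mu> (\<lambda>\<tau>. C * r powr (\<beta> - 1) * (1 / (r powr \<beta> + \<tau>)))"
      using assms by (intro integrable_mult_right stieltjes_measure_one_integrable) auto
    show "AE \<tau> in \<mu>. norm (indicat_real {0<..} \<tau> *\<^sub>R (phi_beta \<beta> (r / \<tau> powr (1/\<beta>)) / \<tau> powr (1/\<beta>)))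
       \<le> norm (C * r powr (\<beta> - 1) * (1 / (r powr \<beta> + \<tau>)))"
    proof (rule AE_I2)
      fix \<tau>
      show "norm (indicat_real {0<..} \<tau> *\<^sub>R (phi_beta \<beta> (r / \<tau> powr (1/\<beta>)) / \<tau> powr (1/\<beta>)))
         \<le> norm (C * r powr (\<beta> - 1) * (1 / (r powr \<beta> + \<tau>)))"
      proof (cases "\<tau> > 0")
        case True
        have "norm (indicat_real {0<..} \<tau> *\<^sub>R (phi_beta \<beta> (r / \<tau> powr (1/\<beta>)) / \<tau> powr (1/\<beta>)))
           = \<bar>phi_beta \<beta> (r / \<tau> powr (1/\<beta>)) / \<tau> powr (1/\<beta>)\<bar>" using True by simp
        also note C(2)[OF assms(4) True]
        also have "C * r powr (\<beta> - 1) * (1 / (r powr \<beta> + \<tau>)) \<le> norm (C * r powr (\<beta> - 1) * (1 / (r powr \<beta> + \<tau>)))"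
          by (simp only: real_norm_def abs_ge_self)
        finally show ?thesis .
      qed simp
    qed
  qed measurable
qed

lemma psi_beta_nonneg:
  assumes "0 < \<beta>" "\<beta> < 1" "r > 0"
  shows "psi_beta \<beta> \<mu> r \<ge> 0"
  unfolding psi_beta_def set_lebesgue_integral_def
  using assms by (intro integral_nonneg_AE AE_I2) (auto simp: indicator_def intro!: divide_nonneg_nonneg phi_beta_nonneg)

lemma psi_integrand_measurable:
  assumes "stieltjes_measure 1 \<mu>"
  shows "(\<lambda>(r, \<tau>). indicat_real {0<..} \<tau> *\<^sub>R (phi_beta \<beta> (r / \<tau> powr (1/\<beta>)) / \<tau> powr (1/\<beta>)))
    \<in> borel_measurable (lborel \<Otimes>\<^sub>M \<mu>)"
proof -
  note id = stieltjes_measure_id_measurable(1)[OF assms]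
  \<comment> \<open>The sigma-algebra of \<open>\<mu>\<close> is the trace of the Borel sets on [0,
    infinity); Borel functions act on it only after passing through this map.\<close>
  have [measurable]: "(\<lambda>p. snd p) \<in> measurable (lborel \<Otimes>\<^sub>M \<mu>) borel"
    by (rule measurable_compose[OF measurable_snd id])
  show ?thesis unfolding split_beta' by measurable
qed

lemma psi_beta_measurable:
  assumes "stieltjes_measure 1 \<mu>"
  shows "psi_beta \<beta> \<mu> \<in> borel_measurable borel"
proof -
  interpret sigma_finite_measure \<mu> by (rule stieltjes_measure_sigma_finite[OF assms]) simp
  have "psi_beta \<beta> \<mu> = (\<lambda>r. LINT \<tau>|\<mu>. indicat_real {0<..} \<tau> *\<^sub>R (phi_beta \<beta> (r / \<tau> powr (1/\<beta>)) / \<tau> powr (1/\<beta>)))"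
    by (simp add: psi_beta_def set_lebesgue_integral_def fun_eq_iff)
  moreover have "\<dots> \<in> borel_measurable lborel"
    by (rule borel_measurable_lebesgue_integral) (use psi_integrand_measurable[OF assms] in \<open>simp add: split_beta'\<close>)
  ultimately show ?thesis by simp
qed

text \<open>Tonelli puts the r-integral inside, where the scaled identity evaluates it for each
  \<tau>. The inner integral defining \<open>psi_beta\<close> becomes a nonnegative integral because
  its integrand is integrable and nonnegative.\<close>

lemma psi_beta_nn_integral:
  assumes "stieltjes_measure 1 \<mu>" "0 < \<beta>" "\<beta> < 1" "s > 0"
  shows "(\<integral>\<^sup>+ r. ennreal (indicator {0<..} r * (psi_beta \<beta> \<mu> r * (s + r) powr (- \<beta>))) \<partial>lborel)
    = (\<integral>\<^sup>+ \<tau>. ennreal (indicator {0<..} \<tau> * (1 / (s powr \<beta> + \<tau>))) \<partial>\<mu>)"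
proof -
  interpret sigma_finite_measure \<mu> by (rule stieltjes_measure_sigma_finite[OF assms(1)]) simp
  interpret P: pair_sigma_finite lborel \<mu> ..
  let ?h = "\<lambda>r \<tau>. indicat_real {0<..} \<tau> *\<^sub>R (phi_beta \<beta> (r / \<tau> powr (1/\<beta>)) / \<tau> powr (1/\<beta>))"
  note [measurable] = psi_integrand_measurable[OF assms(1), of \<beta>] stieltjes_measure_id_measurable(1)[OF assms(1)]
  have hm: "(\<lambda>\<tau>. ?h r \<tau>) \<in> borel_measurable \<mu>" for r by measurable
  have h0: "?h r \<tau> \<ge> 0" if "r > 0" for r \<tau>
    using that phi_beta_nonneg[OF assms(2,3), of "r / \<tau> powr (1/\<beta>)"] by (auto simp: indicator_def)
  have "(\<integral>\<^sup>+ r. ennreal (indicator {0<..} r * (psi_beta \<beta> \<mu> r * (s + r) powr (- \<beta>))) \<partial>lborel)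
     = (\<integral>\<^sup>+ r. (\<integral>\<^sup>+ \<tau>. ennreal (indicator {0<..} r * (?h r \<tau> * (s + r) powr (- \<beta>))) \<partial>\<mu>) \<partial>lborel)"
  proof (rule nn_integral_cong)
    fix r :: real
    show "ennreal (indicator {0<..} r * (psi_beta \<beta> \<mu> r * (s + r) powr (- \<beta>))) =
      (\<integral>\<^sup>+ \<tau>. ennreal (indicator {0<..} r * (?h r \<tau> * (s + r) powr (- \<beta>))) \<partial>\<mu>)"
    proof (cases "r > 0")
      case True
      have int: "integrable \<mu> (?h r)"
        using psi_beta_integrable[OF assms(1-3) True] by (simp add: set_integrable_def)
      then have "(\<integral>\<^sup>+ \<tau>. ennreal (?h r \<tau> * (s + r) powr (- \<beta>)) \<partial>\<mu>) = ennreal (LINT \<tau>|\<mu>. ?h r \<tau> * (s + r) powr (- \<beta>))"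
        using h0[OF True] by (intro nn_integral_eq_integral integrable_mult_left AE_I2 mult_nonneg_nonneg) auto
      also have "(LINT \<tau>|\<mu>. ?h r \<tau> * (s + r) powr (- \<beta>)) = psi_beta \<beta> \<mu> r * (s + r) powr (- \<beta>)"
        unfolding psi_beta_def set_lebesgue_integral_def by (rule integral_mult_left_zero)
      finally show ?thesis using True by simp
    qed simp
  qed
  also have "\<dots> = (\<integral>\<^sup>+ \<tau>. (\<integral>\<^sup>+ r. ennreal (indicator {0<..} r * (?h r \<tau> * (s + r) powr (- \<beta>))) \<partial>lborel) \<partial>\<mu>)"
    by (rule P.Fubini'[symmetric]) measurable
  also have "\<dots> = (\<integral>\<^sup>+ \<tau>. ennreal (indicator {0<..} \<tau> * (1 / (s powr \<beta> + \<tau>))) \<partial>\<mu>)"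
  proof (rule nn_integral_cong)
    fix \<tau> assume "\<tau> \<in> space \<mu>"
    show "(\<integral>\<^sup>+ r. ennreal (indicator {0<..} r * (?h r \<tau> * (s + r) powr (- \<beta>))) \<partial>lborel) =
      ennreal (indicator {0<..} \<tau> * (1 / (s powr \<beta> + \<tau>)))"
      using phi_beta_scaled[OF assms(2,3), of \<tau> s] assms(4) by (cases "\<tau> > 0") simp_all
  qed
  finally show ?thesis .
qed

text \<open>The nonnegative integral is finite since 1/(s^\<beta> + \<tau>) is integrable against
  \<open>\<mu>\<close>; this yields integrability of the \<open>psi_beta\<close> side and equality
  of the real integrals together.\<close>

lemma psi_beta_integral:
  assumes "stieltjes_measure 1 \<mu>" "0 < \<beta>" "\<beta> < 1" "s > 0"
  shows "set_integrable lborel {0<..} (\<lambda>r. psi_beta \<beta> \<mu> r * (s + r) powr (- \<beta>))"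
    and "(LINT r:{0<..}|lborel. psi_beta \<beta> \<mu> r * (s + r) powr (- \<beta>)) = (LINT \<tau>:{0<..}|\<mu>. 1 / (s powr \<beta> + \<tau>))"
proof -
  note [measurable] = psi_beta_measurable[OF assms(1)]
  have m: "(\<lambda>r. indicat_real {0<..} r * (psi_beta \<beta> \<mu> r * (s + r) powr (- \<beta>))) \<in> borel_measurable lborel"
    by measurable
  note [measurable] = stieltjes_measure_id_measurable(4)[OF assms(1)]
  have i: "integrable \<mu> (\<lambda>\<tau>. indicat_real {0<..} \<tau> * (1 / (s powr \<beta> + \<tau>)))"
  proof -
    have "integrable \<mu> (\<lambda>\<tau>. indicat_real {0<..} \<tau> *\<^sub>R (1 / (s powr \<beta> + \<tau>)))"
      using assms by (intro integrable_mult_indicator stieltjes_measure_one_integrable) auto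
    then show ?thesis by simp
  qed
  have eq: "(\<integral>\<^sup>+ r. ennreal (indicator {0<..} r * (psi_beta \<beta> \<mu> r * (s + r) powr (- \<beta>))) \<partial>lborel)
    = ennreal (LINT \<tau>|\<mu>. indicat_real {0<..} \<tau> * (1 / (s powr \<beta> + \<tau>)))"
    unfolding psi_beta_nn_integral[OF assms] using i
    by (intro nn_integral_eq_integral AE_I2) (auto simp: indicator_def)
  have nn: "AE r in lborel. 0 \<le> indicat_real {0<..} r * (psi_beta \<beta> \<mu> r * (s + r) powr (- \<beta>))"
    using psi_beta_nonneg[OF assms(2,3)] by (intro AE_I2) (auto simp: indicator_def)
  have "integrable lborel (\<lambda>r. indicat_real {0<..} r * (psi_beta \<beta> \<mu> r * (s + r) powr (- \<beta>)))"
    by (rule integrableI_nonneg[OF m nn]) (use eq in simp)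
  then show "set_integrable lborel {0<..} (\<lambda>r. psi_beta \<beta> \<mu> r * (s + r) powr (- \<beta>))"
    by (simp add: set_integrable_def)
  have "(LINT r|lborel. indicat_real {0<..} r * (psi_beta \<beta> \<mu> r * (s + r) powr (- \<beta>))) =
     (LINT \<tau>|\<mu>. indicat_real {0<..} \<tau> * (1 / (s powr \<beta> + \<tau>)))"
  proof (subst integral_eq_nn_integral[OF m nn])
    have "0 \<le> (LINT \<tau>|\<mu>. indicat_real {0<..} \<tau> * (1 / (s powr \<beta> + \<tau>)))"
      by (intro integral_nonneg_AE AE_I2) (auto simp: indicator_def)
    then show "enn2real (\<integral>\<^sup>+ r. ennreal (indicator {0<..} r * (psi_beta \<beta> \<mu> r * (s + r) powr (- \<beta>))) \<partial>lborel) =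
      (LINT \<tau>|\<mu>. indicat_real {0<..} \<tau> * (1 / (s powr \<beta> + \<tau>)))"
      unfolding eq by (rule enn2real_ennreal)
  qed
  then show "(LINT r:{0<..}|lborel. psi_beta \<beta> \<mu> r * (s + r) powr (- \<beta>)) = (LINT \<tau>:{0<..}|\<mu>. 1 / (s powr \<beta> + \<tau>))"
    by (simp add: set_lebesgue_integral_def)
qed

lemma stieltjes_transform_one_split:
  assumes "stieltjes_measure 1 \<mu>" "z > 0"
  shows "stieltjes_transform 1 \<mu> z = measure \<mu> {0} / z + (LINT \<tau>:{0<..}|\<mu>. 1 / (z + \<tau>))"
proof -
  note id = stieltjes_measure_id_measurable[OF assms(1)]
  note [measurable] = id(1,3,4)
  have fin: "emeasure \<mu> {0} < \<infinity>" using stieltjes_measure_atMost_finite[OF assms(1), of 0] by simp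
  have i0: "integrable \<mu> (\<lambda>\<tau>. indicat_real {0} \<tau> * (1 / z))"
    using fin id(3) by (intro integrable_mult_left integrable_real_indicator) auto
  have i1: "integrable \<mu> (\<lambda>\<tau>. indicat_real {0<..} \<tau> *\<^sub>R (1 / (z + \<tau>)))"
    using assms by (intro integrable_mult_indicator stieltjes_measure_one_integrable) auto
  have "stieltjes_transform 1 \<mu> z = (LINT \<tau>|\<mu>. indicat_real {0} \<tau> * (1 / z) + indicat_real {0<..} \<tau> *\<^sub>R (1 / (z + \<tau>)))"
    unfolding stieltjes_transform_def
  proof (intro Bochner_Integration.integral_cong refl)
    fix \<tau> assume "\<tau> \<in> space \<mu>"
    then have "\<tau> \<ge> 0" unfolding id(2) by simp
    then show "(z + \<tau>) powr - 1 = indicat_real {0} \<tau> * (1 / z) + indicat_real {0<..} \<tau> *\<^sub>R (1 / (z + \<tau>))"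
      using assms by (cases "\<tau> = 0") (auto simp: powr_minus_divide)
  qed
  also have "\<dots> = (LINT \<tau>|\<mu>. indicat_real {0} \<tau> * (1 / z)) + (LINT \<tau>|\<mu>. indicat_real {0<..} \<tau> *\<^sub>R (1 / (z + \<tau>)))"
    by (rule Bochner_Integration.integral_add[OF i0 i1])
  also have "(LINT \<tau>|\<mu>. indicat_real {0} \<tau> * (1 / z)) = measure \<mu> {0} / z"
    using id(2) by (simp add: Int_absorb2)
  finally show ?thesis by (simp add: set_lebesgue_integral_def)
qed

text \<open>The atom at \<open>0\<close> is the image of the interval \<open>(-1, 0]\<close>, which has Lebesgue measure \<open>1\<close>.\<close>

definition atom_plus_density :: "real \<Rightarrow> (real \<Rightarrow> real) \<Rightarrow> real measure" where
  "atom_plus_density m g = distr (density lborel (\<lambda>r. ennreal (indicator {0<..} r * g r + indicator {-1<..0} r * m)))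
     (restrict_space borel {0..}) (max 0)"

lemma atom_plus_density_class:
  assumes [measurable]: "g \<in> borel_measurable borel" and "m \<ge> 0" and g0: "\<And>r. r > 0 \<Longrightarrow> g r \<ge> 0"
    and int: "\<And>s. s > 0 \<Longrightarrow> set_integrable lborel {0<..} (\<lambda>r. g r * (s + r) powr (- \<beta>))"
  shows "stieltjes_measure \<beta> (atom_plus_density m g)"
    and "s > 0 \<Longrightarrow> stieltjes_transform \<beta> (atom_plus_density m g) s = m * s powr (- \<beta>) +
      (LINT r:{0<..}|lborel. g r * (s + r) powr (- \<beta>))"
proof -
  let ?q = "\<lambda>r. indicat_real {0<..} r * g r + indicat_real {-1<..0} r * m"
  have q0: "?q r \<ge> 0" for r using assms g0[of r] by (auto simp: indicator_def)
  have mx [measurable]: "max 0 \<in> measurable (density lborel (\<lambda>r. ennreal (?q r))) (restrict_space borel {0::real..})"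
    by (intro measurable_restrict_space2) auto
  have qm [measurable]: "?q \<in> borel_measurable borel" by measurable
  have mp: "(\<lambda>t::real. (s + t) powr (- \<beta>)) \<in> borel_measurable (restrict_space borel {0..})" for s
    by (intro measurable_restrict_space1) measurable
  \<comment> \<open>On (-1,0] the kernel is the constant s^(-\<beta>), and r \<le> -1 has density 0;
    values of \<open>g\<close> at r \<le> 0 never enter.\<close>
  have eq: "?q r *\<^sub>R (s + max 0 r) powr (- \<beta>) =
     indicator {0<..} r *\<^sub>R (g r * (s + r) powr (- \<beta>)) + indicat_real {-1<..0} r * (m * s powr (- \<beta>))" for s r
    by (auto simp: indicator_def)
  have I: "integrable lborel (\<lambda>r::real. indicat_real {-1<..0} r * (m * s powr (- \<beta>)))" for s
    by (intro integrable_mult_left integrable_real_indicator) auto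
  have qi: "integrable lborel (\<lambda>r. ?q r *\<^sub>R (s + max 0 r) powr (- \<beta>))"
    "(LINT r|lborel. ?q r *\<^sub>R (s + max 0 r) powr (- \<beta>)) = m * s powr (- \<beta>) + (LINT r:{0<..}|lborel. g r * (s + r) powr (- \<beta>))"
    if "s > 0" for s
    using int[OF that] I[of s] unfolding eq set_integrable_def set_lebesgue_integral_def
    by (auto simp: Bochner_Integration.integral_add)
  show "stieltjes_transform \<beta> (atom_plus_density m g) s = m * s powr (- \<beta>) +
      (LINT r:{0<..}|lborel. g r * (s + r) powr (- \<beta>))" if "s > 0"
  proof -
    have "stieltjes_transform \<beta> (atom_plus_density m g) s = (LINT r|density lborel (\<lambda>r. ennreal (?q r)). (s + max 0 r) powr (- \<beta>))"
      unfolding stieltjes_transform_def atom_plus_density_def by (rule integral_distr[OF mx mp])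
    also have "\<dots> = (LINT r|lborel. ?q r *\<^sub>R (s + max 0 r) powr (- \<beta>))"
      using q0 by (intro integral_density) auto
    finally show ?thesis using qi(2)[OF that] by simp
  qed
  have "(\<integral>\<^sup>+ t. ennreal ((1 + t) powr (- \<beta>)) \<partial>atom_plus_density m g) =
      (\<integral>\<^sup>+ r. ennreal ((1 + max 0 r) powr (- \<beta>)) \<partial>density lborel (\<lambda>r. ennreal (?q r)))"
    unfolding atom_plus_density_def by (rule nn_integral_distr[OF mx]) (use measurable_compose[OF mp[of 1] measurable_ennreal] in simp)
  also have "\<dots> = (\<integral>\<^sup>+ r. ennreal (?q r) * ennreal ((1 + max 0 r) powr (- \<beta>)) \<partial>lborel)"
    by (rule nn_integral_density) auto
  also have "\<dots> = (\<integral>\<^sup>+ r. ennreal (?q r *\<^sub>R (1 + max 0 r) powr (- \<beta>)) \<partial>lborel)"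
    using q0 by (intro nn_integral_cong) (simp add: ennreal_mult)
  also have "\<dots> = ennreal (LINT r|lborel. ?q r *\<^sub>R (1 + max 0 r) powr (- \<beta>))"
    \<comment> \<open>The growth condition defining the measure is the integrability hypothesis at s
      = 1.\<close>
    using qi(1)[of 1] q0 by (intro nn_integral_eq_integral AE_I2) auto
  also have "\<dots> < \<infinity>" by simp
  finally show "stieltjes_measure \<beta> (atom_plus_density m g)"
    by (simp add: stieltjes_measure_def atom_plus_density_def)
qed

theorem theorem6p16:
  fixes f :: "real \<Rightarrow> real" and a \<beta> :: real and \<mu> :: "real measure"
  assumes \<mu>: "stieltjes_measure 1 \<mu>"
    and a: "a \<ge> 0"
    and f: "\<forall>z > 0. f z = a + stieltjes_transform 1 \<mu> z"
    and \<beta>: "0 < \<beta>" "\<beta> < 1"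
  shows "stieltjes_class \<beta> (\<lambda>s. f (s powr \<beta>))
    \<and> (\<forall>r > 0. set_integrable \<mu> {0<..}
          (\<lambda>\<tau>. phi_beta \<beta> (r / \<tau> powr (1/\<beta>)) / \<tau> powr (1/\<beta>)))
    \<and> L1_weighted \<beta> (psi_beta \<beta> \<mu>)
    \<and> (\<forall>s > 0. f (s powr \<beta>) =
          a + measure \<mu> {0} * s powr (-\<beta>)
            + (LINT r:{0<..}|lborel. psi_beta \<beta> \<mu> r / (s + r) powr \<beta>))"
proof (intro conjI allI impI)
  note [measurable] = psi_beta_measurable[OF \<mu>]
  have rep: "f (s powr \<beta>) = a + (measure \<mu> {0} * s powr (-\<beta>) + (LINT r:{0<..}|lborel. psi_beta \<beta> \<mu> r * (s + r) powr (-\<beta>)))"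
    if "s > 0" for s
    using f stieltjes_transform_one_split[OF \<mu>, of "s powr \<beta>"] psi_beta_integral(2)[OF \<mu> \<beta> that] that
    by (simp add: powr_minus_divide)
  show "stieltjes_class \<beta> (\<lambda>s. f (s powr \<beta>))"
    unfolding stieltjes_class_def
  proof (intro exI[of _ a] conjI a exI[of _ "atom_plus_density (measure \<mu> {0}) (psi_beta \<beta> \<mu>)"] allI impI)
    show "stieltjes_measure \<beta> (atom_plus_density (measure \<mu> {0}) (psi_beta \<beta> \<mu>))"
      by (intro atom_plus_density_class psi_beta_nonneg psi_beta_integral \<mu> \<beta>) auto
    show "f (s powr \<beta>) = a + stieltjes_transform \<beta> (atom_plus_density (measure \<mu> {0}) (psi_beta \<beta> \<mu>)) s" if "s > 0" for s
      using that by (subst atom_plus_density_class(2))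
        (auto simp: rep intro!: psi_beta_nonneg psi_beta_integral \<mu> \<beta>)
  qed
  show "set_integrable \<mu> {0<..} (\<lambda>\<tau>. phi_beta \<beta> (r / \<tau> powr (1/\<beta>)) / \<tau> powr (1/\<beta>))" if "r > 0" for r
    by (rule psi_beta_integrable[OF \<mu> \<beta> that])
  show "L1_weighted \<beta> (psi_beta \<beta> \<mu>)"
  proof -
    have "integrable lborel (\<lambda>t. indicat_real {0<..} t *\<^sub>R (psi_beta \<beta> \<mu> t * (1 + t) powr (- \<beta>)))"
      using psi_beta_integral(1)[OF \<mu> \<beta>, of 1] by (simp add: set_integrable_def)
    \<comment> \<open>The weighted space uses the closed half-line, while the integral identity is
      over r > 0; the value at 0 is discarded as a null set.\<close>
    moreover have "AE t in lborel. indicat_real {0<..} t *\<^sub>R (psi_beta \<beta> \<mu> t * (1 + t) powr (- \<beta>)) =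
       indicat_real {0..} t *\<^sub>R ((1 + t) powr (- \<beta>) * psi_beta \<beta> \<mu> t)"
      using AE_lborel_singleton[of "0::real"] by eventually_elim (auto simp: indicator_def)
    ultimately show ?thesis
      unfolding L1_weighted_def set_integrable_def by (subst (asm) integrable_cong_AE) auto
  qed
  show "f (s powr \<beta>) = a + measure \<mu> {0} * s powr (-\<beta>)
            + (LINT r:{0<..}|lborel. psi_beta \<beta> \<mu> r / (s + r) powr \<beta>)" if "s > 0" for s
    unfolding rep[OF that] by (simp add: powr_minus_divide)
qed

end
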